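(* Let $K\ge1$ and consider the Gaussian interference channel with $K+1$ transmitter-receiver pairs, gains $g_{jl}\in\mathbb{C}$ ($j,l\in[0:K]$) and power constraint $Q>0$. The capacity region of this channel with MAC-capacity-achieving codes is contained in $$\mathcal{C}=\bigcap_{j=0}^{K}\mathcal{C}_j,\qquad \mathcal{C}_j=\{\mathbf{R}\in\mathbb{R}_{\ge0}^{K+1}:\ R_{\mathcal S}\in\mathcal{A}_j(\mathcal S)\text{ for some }\mathcal S\subseteq[0:K]\text{ with } j\in\mathcal S\},$$ where, for $j\in\mathcal S\subseteq[0:K]$ and $\mathcal S^c=[0:K]\setminus\mathcal S$, $$\mathcal{A}_j(\mathcal S)=\left\{R_{\mathcal S}:\ \sum_{l\in\mathcal T}R_l\le C\!\left(\frac{\sum_{l\in\mathcal T}P_{jl}}{1+\sum_{l\in\mathcal S^c}P_{jl}}\right)\text{ for every }\mathcal T\subseteq\mathcal S\right\},\qquad P_{jl}=|g_{jl}|^2Q .$$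
   Context: Notation: $[a:b]=\{a,\dots,b\}$; $C(x)=\log_2(1+x)$; $R_{\mathcal S}=(R_l)_{l\in\mathcal S}$. $\mathcal{CN}(0,1)$ is the circularly symmetric complex Gaussian law with variance $1$. Interference channel: at each time receiver $j$ observes $Y_j=\sum_{l=0}^Kg_{jl}X_l+Z_j$ with $Z_j\sim\mathcal{CN}(0,1)$ i.i.d. over time, independent of the messages. Transmitter $j$ sends an independent message $M_j$ uniform on $[1:2^{nR_j}]$ ($2^{nR_j}$ rounded up to an integer) to receiver $j$, which forms an estimate $\hat M_j$ from $Y_j^n$, knowing all codebooks. Codes are deterministic: transmitter $j$ uses codewords $x_j^n(m)\in\mathbb{C}^n$ with $\frac1n\sum_{i=1}^n|x_{ji}(m)|^2\le Q$. MAC-capacity-achieving codes: consider a $k$-transmitter Gaussian multiple access channel (MAC) $Y=\sum_{j=1}^kg_jX_j+Z$, $Z\sim\mathcal{CN}(0,1)$ i.i.d. over time, $g_j\in\mathbb{C}$, and let $P_j=|g_j|^2Q$. A sequence (in $n$) of $(n,2^{nR_1},\dots,2^{nR_k})$ codes (one codebook per transmitter, each satisfying the power constraint $Q$) achieves the rate tuple $R_{\mathcal S}$, $\emptyset\neq\mathcal S\subseteq[1:k]$, over this MAC if, when all $k$ transmitters send independent uniform messages with these codebooks and the receiver estimates the messages $M_j$, $j\in\mathcal S$, from $Y^n$ with suitable decoders, $p_n(\mathcal S)=\frac1{|\mathcal S|}\sum_{j\in\mathcal S}P\{\hat M_j\ne M_j\}\to0$ as $n\to\infty$. The code sequence is MAC-capacity-achieving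 if for every nonempty $\mathcal S\subseteq[1:k]$ it achieves $R_{\mathcal S}$ over every such Gaussian MAC (i.e. for every choice of gains $g_1,\dots,g_k$) for which $$\sum_{l\in\mathcal T}R_l< C\!\left(\frac{\sum_{l\in\mathcal T}P_l}{1+\sum_{l\in[1:k]\setminus\mathcal S}P_l}\right)\quad\text{for every nonempty }\mathcal T\subseteq\mathcal S .$$ A rate tuple $\mathbf R=(R_0,\dots,R_K)$ is achievable on the interference channel via MAC-capacity-achieving codes if there is a sequence of codebooks for the $K+1$ transmitters, at rates $R_0,\dots,R_K$, such that for every subset of $K$ of the transmitters the corresponding codebooks form a MAC-capacity-achieving sequence for $K$-transmitter MACs, and decoders at the receivers such that $p_n=\frac1{K+1}\sum_{j=0}^KP\{\hat M_j\ne M_j\}\to0$. The capacity region with MAC-capacity-achieving codes is the closure of the set of such rate tuples. *)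

theory Defs
  imports "HOL-Probability.Probability" "HOL-Analysis.Analysis"
begin

text \<open>
  Transmitter-receiver pairs are indexed by a finite type \<open>'k\<close> with \<open>K + 1\<close> elements, so rate
  tuples live in \<open>real ^ 'k\<close>. A MAC with \<open>k\<close> transmitters is given by a set \<open>L :: 'k set\<close> of
  transmitters with \<open>card L = k\<close> and gains \<open>h l\<close>, \<open>l \<in> L\<close>. Times are \<open>0, ..., n - 1\<close>.
\<close>

definition gauss_C :: "real \<Rightarrow> real" where
  "gauss_C x = log 2 (1 + x)"

text \<open>The law of a circularly symmetric complex Gaussian of variance 1, i.e. \<open>E|Z|\<^sup>2 = 1\<close>,
  so that the real and imaginary parts have variance \<open>1/2\<close> each.\<close>

definition std_complex_gaussian :: "complex measure" where
  "std_complex_gaussian = density lborel (\<lambda>z. ennreal (exp (- (cmod z)\<^sup>2) / pi))"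

lemma prob_space_std_complex_gaussian: "prob_space std_complex_gaussian"
proof
  have dens: "exp (- (cmod z)\<^sup>2) / pi
      = (\<Prod>b\<in>Basis. normal_density 0 (sqrt (1/2)) (z \<bullet> b))" for z :: complex
    by (simp add: Basis_complex_def normal_density_def cmod_power2 inner_complex_def
        exp_add[symmetric] power_divide)
  have "emeasure std_complex_gaussian (space std_complex_gaussian)
      = (\<integral>\<^sup>+z. (\<Prod>b\<in>Basis. ennreal (normal_density 0 (sqrt (1/2)) (z \<bullet> b))) \<partial>(lborel :: complex measure))"
    unfolding std_complex_gaussian_def
    by (simp add: emeasure_density dens prod_ennreal)
  also have "\<dots> = (\<Prod>b\<in>(Basis :: complex set). \<integral>\<^sup>+x. ennreal (normal_density 0 (sqrt (1/2)) x) \<partial>lborel)"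
    by (rule nn_integral_lborel_prod) auto
  also have "(\<integral>\<^sup>+x. ennreal (normal_density 0 (sqrt (1/2)) x) \<partial>lborel) = 1"
    using prob_space.emeasure_space_1[OF prob_space_normal_density[of "sqrt (1/2)" 0]]
    by (simp add: emeasure_density)
  finally show "emeasure std_complex_gaussian (space std_complex_gaussian) = 1"
    by simp
qed

definition noise_measure :: "nat \<Rightarrow> (nat \<Rightarrow> complex) measure" where
  "noise_measure n = (\<Pi>\<^sub>M i\<in>{..<n}. std_complex_gaussian)"

definition message_set :: "nat \<Rightarrow> real \<Rightarrow> nat set" where
  "message_set n r = {1..nat \<lceil>2 powr (real n * r)\<rceil>}"

text \<open>\<open>c n l m i\<close> is the symbol sent at time \<open>i\<close> by transmitter \<open>l\<close> for message \<open>m\<close> with the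
  codebook of block length \<open>n\<close>. A decoder \<open>d n j\<close> maps the received sequence of length \<open>n\<close>
  to an estimate of message \<open>j\<close>.\<close>

type_synonym 'k code_sequence = "nat \<Rightarrow> 'k \<Rightarrow> nat \<Rightarrow> nat \<Rightarrow> complex"
type_synonym 'k decoders = "nat \<Rightarrow> 'k \<Rightarrow> (nat \<Rightarrow> complex) \<Rightarrow> nat"

definition power_constraint :: "real \<Rightarrow> real ^ 'k \<Rightarrow> 'k set \<Rightarrow> 'k code_sequence \<Rightarrow> bool" where
  "power_constraint Q R L c \<longleftrightarrow>
    (\<forall>n\<ge>1. \<forall>l\<in>L. \<forall>m\<in>message_set n (R $ l). (1 / real n) * (\<Sum>i<n. (cmod (c n l m i))\<^sup>2) \<le> Q)"

definition measurable_decoders :: "'k set \<Rightarrow> 'k decoders \<Rightarrow> bool" where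
  "measurable_decoders S d \<longleftrightarrow>
    (\<forall>n. \<forall>j\<in>S. d n j \<in> measurable (\<Pi>\<^sub>M i\<in>{..<n}. borel) (count_space UNIV))"

definition channel_output ::
    "nat \<Rightarrow> 'k set \<Rightarrow> ('k \<Rightarrow> complex) \<Rightarrow> 'k code_sequence \<Rightarrow> ('k \<Rightarrow> nat) \<Rightarrow> (nat \<Rightarrow> complex) \<Rightarrow> nat \<Rightarrow> complex" where
  "channel_output n L h c m z = (\<lambda>i\<in>{..<n}. (\<Sum>l\<in>L. h l * c n l (m l) i) + z i)"

definition message_noise_space ::
    "nat \<Rightarrow> real ^ 'k \<Rightarrow> 'k set \<Rightarrow> (('k \<Rightarrow> nat) \<times> (nat \<Rightarrow> complex)) measure" where
  "message_noise_space n R L =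
    measure_pmf (Pi_pmf L 0 (\<lambda>l. pmf_of_set (message_set n (R $ l)))) \<Otimes>\<^sub>M noise_measure n"

text \<open>Error probability for message \<open>j\<close> when all transmitters in \<open>L\<close> are active and the gains
  to the receiver in question are \<open>h\<close>.\<close>

definition error_prob ::
    "nat \<Rightarrow> real ^ 'k \<Rightarrow> 'k set \<Rightarrow> ('k \<Rightarrow> complex) \<Rightarrow> 'k code_sequence \<Rightarrow> 'k \<Rightarrow> 'k decoders \<Rightarrow> real" where
  "error_prob n R L h c j d =
    measure (message_noise_space n R L)
      {w \<in> space (message_noise_space n R L).
        d n j (channel_output n L h c (fst w) (snd w)) \<noteq> fst w j}"

definition mac_achieves ::
    "real ^ 'k \<Rightarrow> 'k set \<Rightarrow> 'k set \<Rightarrow> ('k \<Rightarrow> complex) \<Rightarrow> 'k code_sequence \<Rightarrow> bool" where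
  "mac_achieves R L S h c \<longleftrightarrow>
    (\<exists>d. measurable_decoders S d \<and>
      (\<lambda>n. (1 / real (card S)) * (\<Sum>j\<in>S. error_prob n R L h c j d)) \<longlonglongrightarrow> 0)"

definition mac_capacity_achieving ::
    "real \<Rightarrow> real ^ 'k \<Rightarrow> 'k set \<Rightarrow> 'k code_sequence \<Rightarrow> bool" where
  "mac_capacity_achieving Q R L c \<longleftrightarrow>
    power_constraint Q R L c \<and>
    (\<forall>S h. S \<noteq> {} \<longrightarrow> S \<subseteq> L \<longrightarrow>
      (\<forall>T. T \<noteq> {} \<longrightarrow> T \<subseteq> S \<longrightarrow>
        (\<Sum>l\<in>T. R $ l)
          < gauss_C ((\<Sum>l\<in>T. (cmod (h l))\<^sup>2 * Q) / (1 + (\<Sum>l\<in>L - S. (cmod (h l))\<^sup>2 * Q)))) \<longrightarrow>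
      mac_achieves R L S h c)"

text \<open>In the interference channel \<open>g $ j $ l\<close> is the gain from transmitter \<open>l\<close> to receiver \<open>j\<close>.\<close>

definition achievable_mac_codes :: "complex ^ 'k ^ 'k \<Rightarrow> real \<Rightarrow> real ^ 'k \<Rightarrow> bool" where
  "achievable_mac_codes g Q R \<longleftrightarrow>
    (\<forall>j. 0 \<le> R $ j) \<and>
    (\<exists>c. power_constraint Q R UNIV c \<and>
      (\<forall>L. card L = CARD('k) - 1 \<longrightarrow> mac_capacity_achieving Q R L c) \<and>
      (\<exists>d. measurable_decoders UNIV d \<and>
        (\<lambda>n. (1 / real CARD('k)) * (\<Sum>j\<in>UNIV. error_prob n R UNIV (\<lambda>l. g $ j $ l) c j d))
          \<longlonglongrightarrow> 0))"

definition capacity_region_mac_codes :: "complex ^ 'k ^ 'k \<Rightarrow> real \<Rightarrow> (real ^ 'k) set" where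
  "capacity_region_mac_codes g Q = closure {R. achievable_mac_codes g Q R}"

definition rx_power :: "complex ^ 'k ^ 'k \<Rightarrow> real \<Rightarrow> 'k \<Rightarrow> 'k \<Rightarrow> real" where
  "rx_power g Q j l = (cmod (g $ j $ l))\<^sup>2 * Q"

text \<open>A constraint on the subtuple of rates indexed by \<open>S\<close> is represented as the set of all full
  rate tuples whose subtuple satisfies it.\<close>

definition region_A :: "complex ^ 'k ^ 'k \<Rightarrow> real \<Rightarrow> 'k \<Rightarrow> 'k set \<Rightarrow> (real ^ 'k) set" where
  "region_A g Q j S =
    {R. \<forall>T\<subseteq>S. (\<Sum>l\<in>T. R $ l)
      \<le> gauss_C ((\<Sum>l\<in>T. rx_power g Q j l) / (1 + (\<Sum>l\<in>- S. rx_power g Q j l)))}"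

definition region_C :: "complex ^ 'k ^ 'k \<Rightarrow> real \<Rightarrow> 'k \<Rightarrow> (real ^ 'k) set" where
  "region_C g Q j = {R. (\<forall>l. 0 \<le> R $ l) \<and> (\<exists>S. j \<in> S \<and> R \<in> region_A g Q j S)}"

end

theory Submission
  imports Defs
begin

text \<open>
  Fix a receiver \<open>j\<close> and a maximal set \<open>S\<close> containing \<open>j\<close> of messages with vanishing equivocation
  per symbol given the output at \<open>j\<close>. Once these are subtracted, only transmitters in \<open>- S\<close>
  remain, whose codes form a MAC-capacity-achieving sequence; by maximality of \<open>S\<close> none of their
  messages can be decoded. This forces the residual interference plus noise to have
  asymptotically the differential entropy of white Gaussian noise of the same power: raise the
  powers by a common factor until some set \<open>U\<close> just becomes decodable, where a maximality argument
  makes its sum-rate constraint tight; Fano's inequality and induction on the number of undecoded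
  transmitters give a nearly maximal entropy at the raised powers, and the data processing
  inequality for relative entropy to a Gaussian carries this back to the original powers, since
  the entropy deficit can only shrink when Gaussian noise is added. With near-Gaussian
  interference, Fano's inequality and the Gaussian maximum entropy bound yield the constraints
  that define \<open>region_A\<close> for \<open>S\<close>.
\<close>

section \<open>Gaussian densities on complex sequences\<close>

text \<open>The definition of a MAC-capacity-achieving code says when decoding succeeds and nothing
  about what the code looks like when decoding fails, so near-Gaussianity of undecoded interference
  has to be extracted from successful decoding elsewhere. This is possible because one and the same
  code sequence must serve all gains: it may be tested on a fictitious channel with amplified gains,
  and transmitters that are to be ignored get gain 0, which lets a MAC on all of
  \<open>- {j}\<close> stand for one on any subset. Receiver \<open>j\<close> decodes its own
  message, so \<open>- S\<close> always omits \<open>j\<close>, and the assumption on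
  \<open>K\<close> codebooks at a time is enough. Strict inequalities make decodability an open
  condition in the common power factor: at the threshold itself nothing is decodable, so decoding is
  used slightly above it, at an arbitrarily small loss of rate. Since the messages are finitely
  many, every output law is a finite mixture of Gaussian densities, and all information quantities
  are differences of entropies of such mixtures.\<close>

definition cgauss :: "real \<Rightarrow> complex \<Rightarrow> complex \<Rightarrow> real" where
  "cgauss v s z = exp (- (cmod (z - s))\<^sup>2 / v) / (pi * v)"

definition vec_space :: "nat \<Rightarrow> (nat \<Rightarrow> complex) measure" where
  "vec_space n = (\<Pi>\<^sub>M i\<in>{..<n}. lborel)"

text \<open>Only coordinates below \<open>n\<close> count, so centres and signals can be plain
  functions; extensionality concerns only the points of \<open>vec_space n\<close>.\<close>

definition sq_dist :: "nat \<Rightarrow> (nat \<Rightarrow> complex) \<Rightarrow> (nat \<Rightarrow> complex) \<Rightarrow> real" where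
  "sq_dist n x y = (\<Sum>i<n. (cmod (x i - y i))\<^sup>2)"

definition vgauss :: "nat \<Rightarrow> real \<Rightarrow> (nat \<Rightarrow> complex) \<Rightarrow> (nat \<Rightarrow> complex) \<Rightarrow> real" where
  "vgauss n v s y = exp (- sq_dist n y s / v) / (pi * v) ^ n"

lemma cgauss_pos: "v > 0 \<Longrightarrow> cgauss v s z > 0"
  by (simp add: cgauss_def)

lemma cgauss_measurable [measurable]: "cgauss v s \<in> borel_measurable borel"
  unfolding cgauss_def by measurable

lemma cgauss_prod:
  assumes "v > 0"
  shows "cgauss v s z = (\<Prod>b\<in>Basis. normal_density (s \<bullet> b) (sqrt (v/2)) (z \<bullet> b))"
  using assms
  by (simp add: cgauss_def Basis_complex_def normal_density_def cmod_power2 inner_complex_def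
        exp_add[symmetric] power_divide diff_divide_distrib)

lemma nn_integral_normal_density:
  assumes "t > 0" shows "(\<integral>\<^sup>+x. ennreal (normal_density m t x) \<partial>lborel) = 1"
  using prob_space.emeasure_space_1[OF prob_space_normal_density[OF assms, of m]]
  by (simp add: emeasure_density)

text \<open>Expanding around the mean \<open>m\<close> leaves the variance, a cross term killed by
  the first central moment, and the squared bias.\<close>

lemma nn_integral_normal_density_sq:
  assumes "t > 0"
  shows "(\<integral>\<^sup>+x. ennreal (normal_density m t x * (x - a)\<^sup>2) \<partial>lborel) = ennreal (t\<^sup>2 + (m - a)\<^sup>2)"
proof -
  have 2: "has_bochner_integral lborel (\<lambda>x. normal_density m t x * (x - m)\<^sup>2) (t\<^sup>2)"
    using normal_moment_even[OF assms, of m 1] assms by (simp add: power2_eq_square)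
  have 1: "has_bochner_integral lborel (\<lambda>x. normal_density m t x * (x - m)) 0"
    using normal_moment_odd[OF assms, of m 0] by simp
  have 0: "has_bochner_integral lborel (\<lambda>x. normal_density m t x) 1"
    using normal_moment_even[OF assms, of m 0] by simp
  have "has_bochner_integral lborel (\<lambda>x. normal_density m t x * (x - m)\<^sup>2
      + normal_density m t x * (x - m) * (2 * (m - a)) + normal_density m t x * (m - a)\<^sup>2)
     (t\<^sup>2 + 0 * (2 * (m - a)) + 1 * (m - a)\<^sup>2)"
    by (intro has_bochner_integral_add has_bochner_integral_mult_left 0 1 2)
  also have "(\<lambda>x. normal_density m t x * (x - m)\<^sup>2
      + normal_density m t x * (x - m) * (2 * (m - a)) + normal_density m t x * (m - a)\<^sup>2)
     = (\<lambda>x. normal_density m t x * (x - a)\<^sup>2)"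
    by (auto simp: power2_eq_square algebra_simps)
  finally have h: "has_bochner_integral lborel (\<lambda>x. normal_density m t x * (x - a)\<^sup>2)
     (t\<^sup>2 + (m - a)\<^sup>2)" by simp
  have "(\<integral>\<^sup>+x. ennreal (normal_density m t x * (x - a)\<^sup>2) \<partial>lborel)
     = ennreal (\<integral>x. normal_density m t x * (x - a)\<^sup>2 \<partial>lborel)"
    by (rule nn_integral_eq_integral) (use h in \<open>auto intro: integrable.intros\<close>)
  with h show ?thesis by (simp add: has_bochner_integral_integral_eq)
qed

lemma nn_integral_cgauss:
  assumes "v > 0" shows "(\<integral>\<^sup>+z. ennreal (cgauss v s z) \<partial>lborel) = 1"
proof -
  have "(\<integral>\<^sup>+z. ennreal (cgauss v s z) \<partial>lborel)
      = (\<integral>\<^sup>+z. (\<Prod>b\<in>Basis. ennreal (normal_density (s \<bullet> b) (sqrt (v/2)) (z \<bullet> b))) \<partial>lborel)"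
    by (simp add: cgauss_prod[OF assms] prod_ennreal)
  also have "\<dots> = (\<Prod>b\<in>Basis. \<integral>\<^sup>+x. ennreal (normal_density (s \<bullet> b) (sqrt (v/2)) x) \<partial>lborel)"
    by (rule nn_integral_lborel_prod[where f = "\<lambda>b x. ennreal (normal_density (s \<bullet> b) (sqrt (v/2)) x)"]) auto
  finally show ?thesis using assms by (simp add: nn_integral_normal_density)
qed

lemma nn_integral_cgauss_sq:
  assumes "v > 0"
  shows "(\<integral>\<^sup>+z. ennreal (cgauss v s z * (cmod (z - u))\<^sup>2) \<partial>lborel) = ennreal (v + (cmod (s - u))\<^sup>2)"
proof -
  \<comment> \<open>For fixed \<open>c\<close> only coordinate \<open>c\<close> carries its squared
    distance. The integrand thus becomes a sum over \<open>c\<close> of products over the two real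
    coordinates, and each product integrates factor by factor.\<close>
  define f where "f = (\<lambda>c b x. ennreal (normal_density (s \<bullet> b) (sqrt (v/2)) x
      * (if b = c then (x - u \<bullet> c)\<^sup>2 else 1)))"
  have comp: "(\<integral>\<^sup>+z. (\<Prod>b\<in>Basis. f c b (z \<bullet> b)) \<partial>lborel) = ennreal (v / 2 + (s \<bullet> c - u \<bullet> c)\<^sup>2)"
    if "c \<in> Basis" for c :: complex
  proof -
    have "(\<integral>\<^sup>+z. (\<Prod>b\<in>Basis. f c b (z \<bullet> b)) \<partial>lborel) = (\<Prod>b\<in>Basis. \<integral>\<^sup>+x. f c b x \<partial>lborel)"
      by (rule nn_integral_lborel_prod) (auto simp: f_def)
    also have "\<dots> = (\<Prod>b\<in>Basis. if b = c then ennreal (v / 2 + (s \<bullet> c - u \<bullet> c)\<^sup>2) else 1)"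
      using assms by (intro prod.cong)
        (auto simp: f_def nn_integral_normal_density nn_integral_normal_density_sq)
    also have "\<dots> = ennreal (v / 2 + (s \<bullet> c - u \<bullet> c)\<^sup>2)"
      using that by simp
    finally show ?thesis .
  qed
  have "ennreal (cgauss v s z * (cmod (z - u))\<^sup>2) = (\<Sum>c\<in>Basis. \<Prod>b\<in>Basis. f c b (z \<bullet> b))" for z
  proof -
    have "(\<Prod>b\<in>Basis. f c b (z \<bullet> b)) = ennreal (cgauss v s z * (z \<bullet> c - u \<bullet> c)\<^sup>2)"
      if "c \<in> Basis" for c
      using that by (simp add: f_def cgauss_prod[OF assms] prod_ennreal prod.distrib)
    then show ?thesis
      by (simp add: sum_ennreal cgauss_pos[OF assms, THEN less_imp_le] Basis_complex_def
          cmod_power2 inner_complex_def algebra_simps flip: ennreal_plus)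
  qed
  then have "(\<integral>\<^sup>+z. ennreal (cgauss v s z * (cmod (z - u))\<^sup>2) \<partial>lborel)
     = (\<Sum>c\<in>Basis. \<integral>\<^sup>+z. (\<Prod>b\<in>Basis. f c b (z \<bullet> b)) \<partial>lborel)"
    by (subst nn_integral_sum[symmetric]) (auto simp: f_def)
  also have "\<dots> = (\<Sum>c\<in>Basis. ennreal (v / 2 + (s \<bullet> c - u \<bullet> c)\<^sup>2))"
    by (rule sum.cong) (auto simp: comp)
  also have "\<dots> = ennreal (v + (cmod (s - u))\<^sup>2)"
    using assms by (simp add: Basis_complex_def cmod_power2 inner_complex_def flip: ennreal_plus)
  finally show ?thesis .
qed

section \<open>Gaussian densities and Lebesgue measure in dimension n\<close>

lemma sigma_finite_vec_space: "sigma_finite_measure (vec_space n)"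
  unfolding vec_space_def
proof -
  interpret product_sigma_finite "\<lambda>_::nat. lborel :: complex measure" by standard
  show "sigma_finite_measure (\<Pi>\<^sub>M i\<in>{..<n}. (lborel :: complex measure))"
    by (rule sigma_finite) simp
qed

lemma vgauss_prod: "vgauss n v s y = (\<Prod>i<n. cgauss v (s i) (y i))"
  unfolding vgauss_def cgauss_def sq_dist_def
  by (simp add: prod_dividef exp_sum[symmetric] sum_divide_distrib sum_negf)

lemma measurable_vec_coord [measurable]: "i < n \<Longrightarrow> (\<lambda>y. y i) \<in> borel_measurable (vec_space n)"
  unfolding vec_space_def by (auto intro!: measurable_component_singleton simp flip: measurable_lborel1)

lemma sq_dist_measurable [measurable]:
  assumes "\<And>i. i < n \<Longrightarrow> (\<lambda>x. f x i) \<in> borel_measurable M" "\<And>i. i < n \<Longrightarrow> (\<lambda>x. g x i) \<in> borel_measurable M"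
  shows "(\<lambda>x. sq_dist n (f x) (g x)) \<in> borel_measurable M"
  unfolding sq_dist_def
  by (intro borel_measurable_sum borel_measurable_power borel_measurable_diff measurable_compose[OF _ borel_measurable_norm] assms) auto

lemma vgauss_measurable [measurable]:
  assumes "\<And>i. i < n \<Longrightarrow> (\<lambda>x. f x i) \<in> borel_measurable M" "\<And>i. i < n \<Longrightarrow> (\<lambda>x. g x i) \<in> borel_measurable M"
  shows "(\<lambda>x. vgauss n v (f x) (g x)) \<in> borel_measurable M"
  unfolding vgauss_def using assms by measurable

lemma vgauss_pos: "v > 0 \<Longrightarrow> vgauss n v s y > 0"
  by (simp add: vgauss_def)

text \<open>Both sides agree on rectangles. Read one way it gives the coordinate projections behind
  the second moment; read the other way it gives \<open>noise_measure\<close> a density.\<close>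

lemma density_vgauss:
  assumes "v > 0"
  shows "density (vec_space n) (\<lambda>y. ennreal (vgauss n v s y))
    = (\<Pi>\<^sub>M i\<in>{..<n}. density lborel (\<lambda>z. ennreal (cgauss v (s i) z)))"
proof -
  have pr: "prob_space (density lborel (\<lambda>z. ennreal (cgauss v (s i) z)))" for i
    by (rule prob_spaceI) (simp add: emeasure_density nn_integral_cgauss[OF assms])
  interpret G: product_prob_space "\<lambda>i. density lborel (\<lambda>z. ennreal (cgauss v (s i) z))"
    using pr by (intro product_prob_spaceI) auto
  interpret L: product_sigma_finite "\<lambda>_::nat. lborel :: complex measure" by standard
  show ?thesis
  proof (rule G.PiM_eqI)
    show "sets (density (vec_space n) (\<lambda>y. ennreal (vgauss n v s y)))
      = sets (\<Pi>\<^sub>M i\<in>{..<n}. density lborel (\<lambda>z. ennreal (cgauss v (s i) z)))"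
      unfolding vec_space_def by (simp cong: sets_PiM_cong)
  next
    fix A assume A: "\<And>i. i \<in> {..<n} \<Longrightarrow> A i \<in> sets (density lborel (\<lambda>z. ennreal (cgauss v (s i) z)))"
    have A': "\<And>i. i < n \<Longrightarrow> A i \<in> sets borel" using A by auto
    have S: "Pi\<^sub>E {..<n} A \<in> sets (vec_space n)"
      unfolding vec_space_def using A' by (intro sets_PiM_I_finite) auto
    have "emeasure (density (vec_space n) (\<lambda>y. ennreal (vgauss n v s y))) (Pi\<^sub>E {..<n} A)
       = (\<integral>\<^sup>+y. ennreal (vgauss n v s y) * indicator (Pi\<^sub>E {..<n} A) y \<partial>vec_space n)"
      using S by (simp add: emeasure_density)
    also have "\<dots> = (\<integral>\<^sup>+y. (\<Prod>i<n. ennreal (cgauss v (s i) (y i)) * indicator (A i) (y i)) \<partial>vec_space n)"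
    proof (rule nn_integral_cong)
      fix y assume "y \<in> space (vec_space n)"
      then have e: "y \<in> extensional {..<n}" by (auto simp: vec_space_def space_PiM PiE_def)
      have "indicator (Pi\<^sub>E {..<n} A) y = (\<Prod>i<n. indicator (A i) (y i) :: ennreal)"
      proof (cases "y \<in> Pi\<^sub>E {..<n} A")
        case True then show ?thesis by (auto simp: indicator_def PiE_def Pi_def)
      next
        case False
        then obtain i where "i < n" "y i \<notin> A i" using e by (auto simp: PiE_def)
        then have "(\<Prod>i<n. indicator (A i) (y i) :: ennreal) = 0"
          by (intro prod_zero) (auto simp: indicator_def intro!: bexI[of _ i])
        with False show ?thesis by simp
      qed
      then show "ennreal (vgauss n v s y) * indicator (Pi\<^sub>E {..<n} A) y
        = (\<Prod>i<n. ennreal (cgauss v (s i) (y i)) * indicator (A i) (y i))"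
        by (simp add: vgauss_prod prod.distrib prod_ennreal cgauss_pos[OF assms, THEN less_imp_le])
    qed
    also have "\<dots> = (\<Prod>i<n. \<integral>\<^sup>+z. ennreal (cgauss v (s i) z) * indicator (A i) z \<partial>lborel)"
      unfolding vec_space_def
      by (rule L.product_nn_integral_prod[where f = "\<lambda>i z. ennreal (cgauss v (s i) z) * indicator (A i) z"])
        (use A' in \<open>auto intro!: borel_measurable_times_ennreal borel_measurable_indicator\<close>)
    also have "\<dots> = (\<Prod>i<n. emeasure (density lborel (\<lambda>z. ennreal (cgauss v (s i) z))) (A i))"
      using A' by (intro prod.cong) (auto simp: emeasure_density)
    finally show "emeasure (density (vec_space n) (\<lambda>y. ennreal (vgauss n v s y))) (Pi\<^sub>E {..<n} A)
       = (\<Prod>i<n. emeasure (density lborel (\<lambda>z. ennreal (cgauss v (s i) z))) (A i))" .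
  qed simp
qed

lemma prob_space_cgauss: "v > 0 \<Longrightarrow> prob_space (density lborel (\<lambda>z. ennreal (cgauss v s z)))"
  by (rule prob_spaceI) (simp add: emeasure_density nn_integral_cgauss)

lemma nn_integral_vgauss:
  assumes "v > 0" shows "(\<integral>\<^sup>+y. ennreal (vgauss n v s y) \<partial>vec_space n) = 1"
proof -
  have "prob_space (density (vec_space n) (\<lambda>y. ennreal (vgauss n v s y)))"
    unfolding density_vgauss[OF assms] by (intro prob_space_PiM prob_space_cgauss assms)
  then show ?thesis
    using prob_space.emeasure_space_1 by (fastforce simp: emeasure_density)
qed

lemma nn_integral_vgauss_sq:
  assumes "v > 0"
  shows "(\<integral>\<^sup>+y. ennreal (vgauss n v s y * sq_dist n y u) \<partial>vec_space n)
    = ennreal (real n * v + sq_dist n s u)"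
proof -
  let ?G = "\<lambda>i. density lborel (\<lambda>z. ennreal (cgauss v (s i) z))"
  have nn: "0 \<le> cgauss v s z" "0 \<le> vgauss n v s' y" for s z s' y
    using cgauss_pos[OF assms] vgauss_pos[OF assms] by (auto intro: less_imp_le)
  have "(\<integral>\<^sup>+y. ennreal (vgauss n v s y * sq_dist n y u) \<partial>vec_space n)
     = (\<integral>\<^sup>+y. (\<Sum>i<n. ennreal (vgauss n v s y) * ennreal ((cmod (y i - u i))\<^sup>2)) \<partial>vec_space n)"
    by (intro nn_integral_cong)
      (simp add: sq_dist_def sum_distrib_left sum_ennreal nn ennreal_mult[symmetric] flip: sum_distrib_left)
  also have "\<dots> = (\<Sum>i<n. \<integral>\<^sup>+y. ennreal (vgauss n v s y) * ennreal ((cmod (y i - u i))\<^sup>2) \<partial>vec_space n)"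
    by (intro nn_integral_sum) measurable
  also have "\<dots> = (\<Sum>i<n. ennreal (v + (cmod (s i - u i))\<^sup>2))"
  proof (rule sum.cong)
    fix i assume i: "i \<in> {..<n}"
    have "(\<integral>\<^sup>+y. ennreal (vgauss n v s y) * ennreal ((cmod (y i - u i))\<^sup>2) \<partial>vec_space n)
      = (\<integral>\<^sup>+y. ennreal ((cmod (y i - u i))\<^sup>2) \<partial>density (vec_space n) (\<lambda>y. ennreal (vgauss n v s y)))"
      using i by (subst nn_integral_density) auto
    also have "\<dots> = (\<integral>\<^sup>+z. ennreal ((cmod (z - u i))\<^sup>2) \<partial>distr (PiM {..<n} ?G) (?G i) (\<lambda>y. y i))"
      unfolding density_vgauss[OF assms] using i measurable_component_singleton[of i "{..<n}" ?G]
      by (subst nn_integral_distr) auto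
    also have "\<dots> = (\<integral>\<^sup>+z. ennreal ((cmod (z - u i))\<^sup>2) \<partial>?G i)"
      using i prob_space_cgauss[OF assms] by (subst distr_PiM_component) auto
    also have "\<dots> = ennreal (v + (cmod (s i - u i))\<^sup>2)"
      by (subst nn_integral_density) (auto simp: ennreal_mult[symmetric] nn nn_integral_cgauss_sq[OF assms])
    finally show "(\<integral>\<^sup>+y. ennreal (vgauss n v s y) * ennreal ((cmod (y i - u i))\<^sup>2) \<partial>vec_space n)
       = ennreal (v + (cmod (s i - u i))\<^sup>2)" .
  qed simp
  also have "\<dots> = ennreal (real n * v + sq_dist n s u)"
    using assms by (subst sum_ennreal) (auto simp: sq_dist_def sum.distrib)
  finally show ?thesis .
qed

lemma noise_measure_density: "noise_measure n = density (vec_space n) (\<lambda>y. ennreal (vgauss n 1 (\<lambda>_. 0) y))"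
  by (simp add: density_vgauss noise_measure_def std_complex_gaussian_def cgauss_def)

text \<open>Each complex coordinate is scaled in two real dimensions, hence the factor
  \<open>a ^ (2 * n)\<close>. With \<open>a = 1\<close> this is translation invariance; with
  \<open>a = sqrt b\<close> it relates amplified outputs to original ones.\<close>

lemma vec_space_affine:
  assumes "a > 0"
  shows "vec_space n = density (distr (vec_space n) (vec_space n) (\<lambda>y. \<lambda>i\<in>{..<n}. s i + complex_of_real a * y i))
    (\<lambda>_. ennreal (a ^ (2 * n)))"
proof -
  interpret L: product_sigma_finite "\<lambda>_::nat. lborel :: complex measure" by standard
  let ?T = "\<lambda>y. \<lambda>i\<in>{..<n}. s i + complex_of_real a * y i"
  have T[measurable]: "?T \<in> measurable (vec_space n) (vec_space n)"
    by (subst (2) vec_space_def, intro measurable_restrict) simp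
  have one: "emeasure lborel A = ennreal (a\<^sup>2) * emeasure lborel ((\<lambda>z. s i + complex_of_real a * z) -` A)"
    if "A \<in> sets borel" for A i
  proof -
    have "emeasure lborel A
      = emeasure (density (distr lborel borel (\<lambda>x. s i + a *\<^sub>R x)) (\<lambda>_. ennreal (\<bar>a\<bar> ^ DIM(complex)))) A"
      by (subst lborel_affine[of a "s i"]) (use assms in auto)
    also have "\<dots> = ennreal (a\<^sup>2) * emeasure lborel ((\<lambda>z. s i + complex_of_real a * z) -` A)"
      using that assms
      by (simp add: emeasure_density_const emeasure_distr scaleR_conv_of_real)
    finally show ?thesis .
  qed
  show ?thesis
    unfolding vec_space_def
  proof (rule L.PiM_eqI[symmetric])
    fix A assume A: "\<And>i. i \<in> {..<n} \<Longrightarrow> A i \<in> sets (lborel :: complex measure)"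
    have S: "Pi\<^sub>E {..<n} A \<in> sets (vec_space n)"
      unfolding vec_space_def using A by (intro sets_PiM_I_finite) auto
    have "?T -` Pi\<^sub>E {..<n} A \<inter> space (vec_space n) = Pi\<^sub>E {..<n} (\<lambda>i. (\<lambda>z. s i + complex_of_real a * z) -` A i)"
      by (auto simp: vec_space_def space_PiM PiE_def Pi_def)
    moreover have "(\<lambda>z. s i + complex_of_real a * z) -` A i \<in> sets lborel" if "i < n" for i
      using measurable_sets[of "\<lambda>z. s i + complex_of_real a * z" borel borel "A i"] A[of i] that
      by simp
    ultimately have "emeasure (density (distr (vec_space n) (vec_space n) ?T) (\<lambda>_. ennreal (a ^ (2 * n)))) (Pi\<^sub>E {..<n} A)
       = ennreal (a ^ (2 * n)) * (\<Prod>i<n. emeasure lborel ((\<lambda>z. s i + complex_of_real a * z) -` A i))"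
      using S by (simp add: emeasure_density_const emeasure_distr) (subst vec_space_def, subst L.emeasure_PiM, auto)
    also have "\<dots> = (\<Prod>i<n. ennreal (a\<^sup>2) * emeasure lborel ((\<lambda>z. s i + complex_of_real a * z) -` A i))"
      using assms by (simp add: prod.distrib power_mult ennreal_power)
    also have "\<dots> = (\<Prod>i<n. emeasure lborel (A i))"
      using A by (intro prod.cong) (auto simp flip: one)
    finally show "emeasure (density (distr (Pi\<^sub>M {..<n} (\<lambda>i. lborel)) (Pi\<^sub>M {..<n} (\<lambda>i. lborel)) ?T)
          (\<lambda>_. ennreal (a ^ (2 * n)))) (Pi\<^sub>E {..<n} A) = (\<Prod>i<n. emeasure lborel (A i))"
      by (simp add: vec_space_def)
  qed auto
qed

section \<open>Differential entropy of Gaussian mixtures\<close>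

lemma sq_dist_nonneg [simp]: "0 \<le> sq_dist n x y"
  by (simp add: sq_dist_def sum_nonneg)

lemma sq_dist_triangle: "sq_dist n x z \<le> 2 * sq_dist n x y + 2 * sq_dist n y z"
proof -
  have "(cmod (x i - z i))\<^sup>2 \<le> 2 * (cmod (x i - y i))\<^sup>2 + 2 * (cmod (y i - z i))\<^sup>2" for i
  proof -
    have "cmod (x i - z i) \<le> cmod (x i - y i) + cmod (y i - z i)"
      using norm_triangle_ineq[of "x i - y i" "y i - z i"] by simp
    then have "(cmod (x i - z i))\<^sup>2 \<le> (cmod (x i - y i) + cmod (y i - z i))\<^sup>2"
      by (intro power_mono) auto
    also have "\<dots> \<le> 2 * (cmod (x i - y i))\<^sup>2 + 2 * (cmod (y i - z i))\<^sup>2"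
      using sum_squares_bound[of "cmod (x i - y i)" "cmod (y i - z i)"] by (simp add: power2_sum)
    finally show ?thesis .
  qed
  then show ?thesis
    unfolding sq_dist_def sum_distrib_left sum.distrib[symmetric] by (intro sum_mono)
qed

lemma integral_vgauss:
  assumes "v > 0"
  shows "integrable (vec_space n) (vgauss n v s)" "(\<integral>y. vgauss n v s y \<partial>vec_space n) = 1"
proof -
  have "has_bochner_integral (vec_space n) (vgauss n v s) 1"
    using nn_integral_vgauss[OF assms, of n s] vgauss_pos[OF assms]
    by (intro has_bochner_integral_nn_integral) (auto intro!: AE_I2 less_imp_le)
  then show "integrable (vec_space n) (vgauss n v s)" "(\<integral>y. vgauss n v s y \<partial>vec_space n) = 1"
    by (auto simp: has_bochner_integral_iff)
qed

lemma integral_vgauss_sq: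
  assumes "v > 0"
  shows "integrable (vec_space n) (\<lambda>y. vgauss n v s y * sq_dist n y u)"
    "(\<integral>y. vgauss n v s y * sq_dist n y u \<partial>vec_space n) = real n * v + sq_dist n s u"
proof -
  have "has_bochner_integral (vec_space n) (\<lambda>y. vgauss n v s y * sq_dist n y u) (real n * v + sq_dist n s u)"
    using nn_integral_vgauss_sq[OF assms, of n s u] vgauss_pos[OF assms] assms
    by (intro has_bochner_integral_nn_integral) (auto intro!: AE_I2 mult_nonneg_nonneg intro: less_imp_le)
  then show "integrable (vec_space n) (\<lambda>y. vgauss n v s y * sq_dist n y u)"
    "(\<integral>y. vgauss n v s y * sq_dist n y u \<partial>vec_space n) = real n * v + sq_dist n s u"
    by (auto simp: has_bochner_integral_iff)
qed

text \<open>Logarithms of Gaussian mixtures grow at most quadratically, which makes them integrable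
  against every Gaussian.\<close>

definition quad_bounded :: "nat \<Rightarrow> ((nat \<Rightarrow> complex) \<Rightarrow> real) \<Rightarrow> bool" where
  "quad_bounded n \<psi> \<longleftrightarrow> \<psi> \<in> borel_measurable (vec_space n) \<and>
    (\<exists>a\<ge>0. \<exists>b\<ge>0. \<forall>y. \<bar>\<psi> y\<bar> \<le> a + b * sq_dist n y (\<lambda>_. 0))"

text \<open>The centre \<open>u\<close> is free, since moving it to the origin costs a factor 2 and
  a constant. Later it is a codeword.\<close>

lemma quad_boundedI:
  assumes "\<psi> \<in> borel_measurable (vec_space n)" "a \<ge> 0" "b \<ge> 0" "\<And>y. \<bar>\<psi> y\<bar> \<le> a + b * sq_dist n y u"
  shows "quad_bounded n \<psi>"
  unfolding quad_bounded_def
proof (intro conjI exI allI)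
  fix y
  have "\<bar>\<psi> y\<bar> \<le> a + b * sq_dist n y u" by fact
  also have "\<dots> \<le> a + b * (2 * sq_dist n y (\<lambda>_. 0) + 2 * sq_dist n (\<lambda>_. 0) u)"
    using assms sq_dist_triangle by (intro add_left_mono mult_left_mono)
  finally show "\<bar>\<psi> y\<bar> \<le> (a + 2 * b * sq_dist n (\<lambda>_. 0) u) + (2 * b) * sq_dist n y (\<lambda>_. 0)"
    by (simp add: algebra_simps)
qed (use assms in auto)

lemma quad_boundedE:
  assumes "quad_bounded n \<psi>"
  obtains a b where "a \<ge> 0" "b \<ge> 0" "\<And>y. \<bar>\<psi> y\<bar> \<le> a + b * sq_dist n y (\<lambda>_. 0)"
  using assms unfolding quad_bounded_def by blast

lemma quad_bounded_measurable: "quad_bounded n \<psi> \<Longrightarrow> \<psi> \<in> borel_measurable (vec_space n)"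
  by (simp add: quad_bounded_def)

lemma quad_bounded_const: "quad_bounded n (\<lambda>_. c)"
  by (rule quad_boundedI[where a = "\<bar>c\<bar>" and b = 0]) auto

lemma quad_bounded_sq_dist: "quad_bounded n (\<lambda>y. sq_dist n y u)"
  by (rule quad_boundedI[where a = 0 and b = 1 and u = u]) auto

lemma quad_bounded_add:
  assumes "quad_bounded n f" "quad_bounded n g" shows "quad_bounded n (\<lambda>y. f y + g y)"
proof -
  obtain a b where ab: "a \<ge> 0" "b \<ge> 0" "\<And>y. \<bar>f y\<bar> \<le> a + b * sq_dist n y (\<lambda>_. 0)"
    using quad_boundedE[OF assms(1)] by blast
  obtain c d where cd: "c \<ge> 0" "d \<ge> 0" "\<And>y. \<bar>g y\<bar> \<le> c + d * sq_dist n y (\<lambda>_. 0)"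
    using quad_boundedE[OF assms(2)] by blast
  show ?thesis
  proof (rule quad_boundedI)
    fix y show "\<bar>f y + g y\<bar> \<le> (a + c) + (b + d) * sq_dist n y (\<lambda>_. 0)"
      using ab(3)[of y] cd(3)[of y] by (simp add: algebra_simps)
  qed (use ab cd assms[THEN quad_bounded_measurable] in auto)
qed

lemma quad_bounded_cmult:
  assumes "quad_bounded n f" shows "quad_bounded n (\<lambda>y. c * f y)"
proof -
  obtain a b where ab: "a \<ge> 0" "b \<ge> 0" "\<And>y. \<bar>f y\<bar> \<le> a + b * sq_dist n y (\<lambda>_. 0)"
    using quad_boundedE[OF assms(1)] by blast
  show ?thesis
  proof (rule quad_boundedI)
    fix y show "\<bar>c * f y\<bar> \<le> (\<bar>c\<bar> * a) + (\<bar>c\<bar> * b) * sq_dist n y (\<lambda>_. 0)"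
      using mult_left_mono[OF ab(3)[of y], of "\<bar>c\<bar>"] by (simp add: algebra_simps abs_mult)
  qed (use ab assms[THEN quad_bounded_measurable] in auto)
qed

lemma quad_bounded_diff:
  assumes "quad_bounded n f" "quad_bounded n g" shows "quad_bounded n (\<lambda>y. f y - g y)"
  using quad_bounded_add[OF assms(1) quad_bounded_cmult[OF assms(2), of "-1"]] by simp

lemma integrable_vgauss_mult:
  assumes "v > 0" "quad_bounded n \<psi>"
  shows "integrable (vec_space n) (\<lambda>y. vgauss n v s y * \<psi> y)"
proof -
  obtain a b where ab: "a \<ge> 0" "b \<ge> 0" "\<And>y. \<bar>\<psi> y\<bar> \<le> a + b * sq_dist n y (\<lambda>_. 0)"
    using quad_boundedE[OF assms(2)] by blast
  have [measurable]: "\<psi> \<in> borel_measurable (vec_space n)"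
    using assms(2) by (rule quad_bounded_measurable)
  show ?thesis
  proof (rule Bochner_Integration.integrable_bound)
    show "integrable (vec_space n) (\<lambda>y. a * vgauss n v s y + b * (vgauss n v s y * sq_dist n y (\<lambda>_. 0)))"
      using integral_vgauss[OF assms(1)] integral_vgauss_sq[OF assms(1)] by auto
    show "AE y in vec_space n. norm (vgauss n v s y * \<psi> y)
      \<le> norm (a * vgauss n v s y + b * (vgauss n v s y * sq_dist n y (\<lambda>_. 0)))"
    proof (rule AE_I2)
      fix y
      have "\<bar>\<psi> y\<bar> * vgauss n v s y \<le> (a + b * sq_dist n y (\<lambda>_. 0)) * vgauss n v s y"
        using ab(3)[of y] vgauss_pos[OF assms(1), of n s y] by (intro mult_right_mono) auto
      then show "norm (vgauss n v s y * \<psi> y)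
        \<le> norm (a * vgauss n v s y + b * (vgauss n v s y * sq_dist n y (\<lambda>_. 0)))"
        using vgauss_pos[OF assms(1), of n s y] by (simp add: abs_mult algebra_simps abs_of_pos)
    qed
  qed measurable
qed

definition mixture :: "nat \<Rightarrow> real \<Rightarrow> 'm set \<Rightarrow> ('m \<Rightarrow> nat \<Rightarrow> complex) \<Rightarrow> (nat \<Rightarrow> complex) \<Rightarrow> real" where
  "mixture n v A s y = (\<Sum>m\<in>A. vgauss n v (s m) y) / real (card A)"

text \<open>Measured in nats; the passage to bits is made in \<open>entropy_excess\<close> and
  \<open>message_rate\<close>.\<close>

definition diff_entropy :: "nat \<Rightarrow> ((nat \<Rightarrow> complex) \<Rightarrow> real) \<Rightarrow> real" where
  "diff_entropy n f = - (\<integral>y. f y * ln (f y) \<partial>vec_space n)"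

lemma mixture_measurable [measurable]: "mixture n v A s \<in> borel_measurable (vec_space n)"
  unfolding mixture_def by (intro borel_measurable_divide borel_measurable_sum) auto

lemma mixture_pos:
  assumes "v > 0" "finite A" "A \<noteq> {}" shows "mixture n v A s y > 0"
  unfolding mixture_def using assms by (intro divide_pos_pos sum_pos vgauss_pos) (auto simp: card_gt_0_iff)

lemma vgauss_le: "v > 0 \<Longrightarrow> vgauss n v s y \<le> 1 / (pi * v) ^ n"
  unfolding vgauss_def by (intro divide_right_mono) auto

lemma ln_vgauss: "v > 0 \<Longrightarrow> ln (vgauss n v s y) = - sq_dist n y s / v - real n * ln (pi * v)"
  by (simp add: vgauss_def ln_div ln_realpow)

lemma quad_bounded_ln_vgauss: "v > 0 \<Longrightarrow> quad_bounded n (\<lambda>y. ln (vgauss n v s y))"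
  using quad_bounded_diff[OF quad_bounded_cmult[OF quad_bounded_sq_dist[of n s], of "- 1 / v"] quad_bounded_const[of n "real n * ln (pi * v)"]]
  by (simp add: ln_vgauss)

text \<open>From above a mixture is bounded by the peak \<open>1 / (pi * v) ^ n\<close> of one
  Gaussian; from below it dominates any single summand divided by \<open>card A\<close>, whose
  logarithm is quadratic in \<open>y\<close>.\<close>

lemma quad_bounded_ln_mixture:
  assumes "v > 0" "finite A" "A \<noteq> {}"
  shows "quad_bounded n (\<lambda>y. ln (mixture n v A s y))"
proof -
  obtain m where m: "m \<in> A" using assms by auto
  have c: "real (card A) > 0" using assms by (auto simp: card_gt_0_iff)
  have up: "ln (mixture n v A s y) \<le> - (real n * ln (pi * v))" for y
  proof -
    have "(\<Sum>m\<in>A. vgauss n v (s m) y) \<le> (\<Sum>m\<in>A. 1 / (pi * v) ^ n)"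
      using assms by (intro sum_mono vgauss_le)
    then have "mixture n v A s y \<le> 1 / (pi * v) ^ n"
      unfolding mixture_def using c by (simp add: field_simps)
    then have "ln (mixture n v A s y) \<le> ln (1 / (pi * v) ^ n)"
      using mixture_pos[OF assms] by (rule ln_mono)
    then show ?thesis using assms by (simp add: ln_div ln_realpow)
  qed
  have lo: "ln (mixture n v A s y) \<ge> - sq_dist n y (s m) / v - real n * ln (pi * v) - ln (card A)" for y
  proof -
    have "vgauss n v (s m) y \<le> (\<Sum>m\<in>A. vgauss n v (s m) y)"
      using m assms vgauss_pos[OF assms(1)] by (intro member_le_sum) (auto intro: less_imp_le)
    then have "vgauss n v (s m) y / card A \<le> mixture n v A s y"
      unfolding mixture_def using c by (simp add: divide_right_mono)
    then have "ln (vgauss n v (s m) y / card A) \<le> ln (mixture n v A s y)"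
      using mixture_pos[OF assms] vgauss_pos[OF assms(1)] c by simp
    then show ?thesis using assms c vgauss_pos[OF assms(1), of n "s m" y] by (simp add: ln_div ln_vgauss)
  qed
  show ?thesis
  proof (rule quad_boundedI)
    fix y
    have "0 \<le> ln (real (card A))" using c by simp
    then show "\<bar>ln (mixture n v A s y)\<bar> \<le> (\<bar>real n * ln (pi * v)\<bar> + ln (card A)) + (1 / v) * sq_dist n y (s m)"
      using up[of y] lo[of y] sq_dist_nonneg[of n y "s m"] assms(1)
      by (smt (verit) divide_minus_left divide_nonneg_pos mult_cancel_right1 times_divide_eq_left)
  qed (use c assms in auto)
qed

lemma mixture_mult_eq: "mixture n v A s y * \<psi> y = (\<Sum>m\<in>A. vgauss n v (s m) y * \<psi> y) / real (card A)"
  by (simp add: mixture_def sum_distrib_right)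

lemma integral_mixture_mult:
  assumes "v > 0" "quad_bounded n \<psi>"
  shows "integrable (vec_space n) (\<lambda>y. mixture n v A s y * \<psi> y)"
    "(\<integral>y. mixture n v A s y * \<psi> y \<partial>vec_space n)
      = (\<Sum>m\<in>A. \<integral>y. vgauss n v (s m) y * \<psi> y \<partial>vec_space n) / real (card A)"
  unfolding mixture_mult_eq using integrable_vgauss_mult[OF assms] by (auto simp: Bochner_Integration.integral_sum)

lemma integral_mixture:
  assumes "v > 0" "finite A" "A \<noteq> {}"
  shows "integrable (vec_space n) (mixture n v A s)" "(\<integral>y. mixture n v A s y \<partial>vec_space n) = 1"
  using integral_mixture_mult[OF assms(1) quad_bounded_const[of n 1], of A s] integral_vgauss[OF assms(1)]
    assms by auto

text \<open>This is \<open>ln t \<le> t - 1\<close> at \<open>t = q x / p x\<close>. Neither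
  function has to have mass 1: the difference of the masses stays on the right, which Fano's
  inequality exploits by treating one message at a time.\<close>

lemma gibbs_inequality:
  fixes p q :: "'a \<Rightarrow> real"
  assumes "integrable M p" "integrable M q" "\<And>x. p x > 0" "\<And>x. q x > 0"
    and "integrable M (\<lambda>x. p x * (ln (q x) - ln (p x)))"
  shows "(\<integral>x. p x * (ln (q x) - ln (p x)) \<partial>M) \<le> (\<integral>x. q x \<partial>M) - (\<integral>x. p x \<partial>M)"
proof -
  have "(\<integral>x. p x * (ln (q x) - ln (p x)) \<partial>M) \<le> (\<integral>x. q x - p x \<partial>M)"
  proof (rule integral_mono)
    fix x
    have "ln (q x / p x) \<le> q x / p x - 1" using assms(3,4)[of x] by (intro ln_le_minus_one) auto
    then have "p x * (ln (q x) - ln (p x)) \<le> p x * (q x / p x - 1)"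
      using assms(3,4)[of x] by (simp add: ln_div)
    then show "p x * (ln (q x) - ln (p x)) \<le> q x - p x" using assms(3)[of x] by (simp add: algebra_simps)
  qed (use assms in auto)
  then show ?thesis using assms by simp
qed

text \<open>Gibbs' inequality against a Gaussian of variance \<open>N\<close> centred at
  \<open>u\<close>: the cross entropy sees only the second moment of the mixture about
  \<open>u\<close>. The centre is left free so that it can later be the mean signal.\<close>

lemma diff_entropy_mixture_le:
  assumes "v > 0" "finite A" "A \<noteq> {}" "N > 0"
  shows "diff_entropy n (mixture n v A s)
    \<le> real n * ln (pi * N) + (real n * v + (\<Sum>m\<in>A. sq_dist n (s m) u) / real (card A)) / N"
proof -
  let ?f = "mixture n v A s" and ?g = "vgauss n N u"
  note qf = quad_bounded_ln_mixture[OF assms(1-3), of n s]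
  note qg = quad_bounded_ln_vgauss[OF assms(4), of n u]
  have c: "card A > 0" using assms by (auto simp: card_gt_0_iff)
  have "(\<integral>y. ?f y * (ln (?g y) - ln (?f y)) \<partial>vec_space n) \<le> (\<integral>y. ?g y \<partial>vec_space n) - (\<integral>y. ?f y \<partial>vec_space n)"
    by (rule gibbs_inequality)
      (use assms in \<open>simp_all add: integral_mixture integral_vgauss mixture_pos vgauss_pos
         integral_mixture_mult(1)[OF assms(1) quad_bounded_diff[OF qg qf]]\<close>)
  also have "\<dots> = 0" using assms by (simp add: integral_mixture integral_vgauss)
  finally have "(\<integral>y. ?f y * (ln (?g y) - ln (?f y)) \<partial>vec_space n) \<le> 0" .
  then have "diff_entropy n ?f \<le> - (\<integral>y. ?f y * ln (?g y) \<partial>vec_space n)"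
    unfolding diff_entropy_def right_diff_distrib
    using integral_mixture_mult(1)[OF assms(1) qf, of A s] integral_mixture_mult(1)[OF assms(1) qg, of A s]
    by simp
  also have "\<dots> = (\<integral>y. (1 / N) * (?f y * sq_dist n y u) + (real n * ln (pi * N)) * ?f y \<partial>vec_space n)"
    unfolding integral_minus[symmetric]
    by (rule Bochner_Integration.integral_cong) (use assms in \<open>auto simp: ln_vgauss field_simps\<close>)
  also have "\<dots> = (1 / N) * (\<integral>y. ?f y * sq_dist n y u \<partial>vec_space n) + real n * ln (pi * N)"
    using integral_mixture[OF assms(1-3)] integral_mixture_mult(1)[OF assms(1) quad_bounded_sq_dist[of n u], of A s]
    by simp
  also have "(\<integral>y. ?f y * sq_dist n y u \<partial>vec_space n) = (real n * v + (\<Sum>m\<in>A. sq_dist n (s m) u) / real (card A))"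
    using integral_mixture_mult(2)[OF assms(1) quad_bounded_sq_dist[of n u], of A s] c assms(1)
    by (simp add: integral_vgauss_sq sum.distrib add_divide_distrib)
  finally show ?thesis by (simp add: mult.commute divide_inverse)
qed

lemma diff_entropy_vgauss:
  assumes "v > 0" shows "diff_entropy n (vgauss n v s) = real n * ln (pi * v) + real n"
proof -
  have "diff_entropy n (vgauss n v s)
     = (\<integral>y. (1 / v) * (vgauss n v s y * sq_dist n y s) + (real n * ln (pi * v)) * vgauss n v s y \<partial>vec_space n)"
    unfolding diff_entropy_def integral_minus[symmetric]
    by (rule Bochner_Integration.integral_cong) (use assms in \<open>auto simp: ln_vgauss field_simps\<close>)
  also have "\<dots> = (1 / v) * (real n * v + sq_dist n s s) + real n * ln (pi * v)"
    using integral_vgauss[OF assms] integral_vgauss_sq[OF assms] by simp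
  finally show ?thesis using assms by (simp add: sq_dist_def)
qed

lemma sq_dist_affine:
  "sq_dist n (\<lambda>i\<in>{..<n}. t i + complex_of_real a * y i) (\<lambda>i. t i + complex_of_real a * s i) = a\<^sup>2 * sq_dist n y s"
  by (auto simp: sq_dist_def sum_distrib_left norm_mult power_mult_distrib simp flip: right_diff_distrib)

lemma diff_entropy_affine:
  assumes "v > 0" "a > 0" "finite A" "A \<noteq> {}"
  shows "diff_entropy n (mixture n (a\<^sup>2 * v) A (\<lambda>m i. t i + complex_of_real a * s m i))
    = diff_entropy n (mixture n v A s) + 2 * real n * ln a"
proof -
  let ?T = "\<lambda>y. \<lambda>i\<in>{..<n}. t i + complex_of_real a * y i"
  let ?f = "mixture n v A s"
  let ?g = "mixture n (a\<^sup>2 * v) A (\<lambda>m i. t i + complex_of_real a * s m i)"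
  have T[measurable]: "?T \<in> measurable (vec_space n) (vec_space n)"
    by (subst (2) vec_space_def, intro measurable_restrict) simp
  have g: "?g (?T y) = ?f y / a ^ (2 * n)" for y
    using assms
    by (simp add: mixture_def vgauss_def sq_dist_affine power_mult_distrib power_mult
      flip: sum_divide_distrib)
  have m: "(\<lambda>y. ?g y * ln (?g y)) \<in> borel_measurable (vec_space n)" by measurable
  have "(\<integral>y. ?g y * ln (?g y) \<partial>vec_space n)
     = (\<integral>y. ?g y * ln (?g y) \<partial>density (distr (vec_space n) (vec_space n) ?T) (\<lambda>_. ennreal (a ^ (2 * n))))"
    using vec_space_affine[OF assms(2), of n t] by simp
  also have "\<dots> = (\<integral>y. a ^ (2 * n) * (?g (?T y) * ln (?g (?T y))) \<partial>vec_space n)"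
    using assms m by (subst integral_density) (auto simp: integral_distr)
  also have "\<dots> = (\<integral>y. ?f y * ln (?f y) - (2 * real n * ln a) * ?f y \<partial>vec_space n)"
    unfolding g using assms mixture_pos[OF assms(1,3,4), of n s]
    by (intro Bochner_Integration.integral_cong) (auto simp: ln_div ln_realpow algebra_simps)
  also have "\<dots> = (\<integral>y. ?f y * ln (?f y) \<partial>vec_space n) - 2 * real n * ln a"
    using integral_mixture[OF assms(1,3,4)]
      integral_mixture_mult(1)[OF assms(1) quad_bounded_ln_mixture[OF assms(1,3,4), of n s], of A s]
    by simp
  finally show ?thesis by (simp add: diff_entropy_def)
qed

section \<open>Data processing for added Gaussian noise\<close>

lemma measurable_vec_fst [measurable]: "i < n \<Longrightarrow> (\<lambda>x. fst x i) \<in> borel_measurable (vec_space n \<Otimes>\<^sub>M N)"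
  by (rule measurable_compose[OF measurable_fst measurable_vec_coord])

lemma measurable_vec_snd [measurable]: "i < n \<Longrightarrow> (\<lambda>x. snd x i) \<in> borel_measurable (N \<Otimes>\<^sub>M vec_space n)"
  by (rule measurable_compose[OF measurable_snd measurable_vec_coord])

text \<open>Completing the square, or Bayes' rule: a Gaussian prior of variance \<open>v1\<close>
  followed by Gaussian noise of variance \<open>v2\<close> equals the output density times the
  posterior density, whose mean is the weighted average of \<open>s\<close> and
  \<open>w\<close>.\<close>

lemma cgauss_mult:
  assumes "v1 > 0" "v2 > 0"
  shows "cgauss v1 s x * cgauss v2 x w
    = cgauss (v1 + v2) s w * cgauss (v1 * v2 / (v1 + v2)) ((of_real v2 * s + of_real v1 * w) / of_real (v1 + v2)) x"
proof -
  have n0: "v1 + v2 \<noteq> 0" using assms by simp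
  define c where "c = (of_real v2 * s + of_real v1 * w) / complex_of_real (v1 + v2)"
  have cc: "x - c = (of_real v2 * (x - s) + of_real v1 * (x - w)) / complex_of_real (v1 + v2)"
    unfolding c_def using n0
    by (simp add: field_simps del: of_real_add) (simp add: algebra_simps)
  have "(cmod (x - c))\<^sup>2 = (cmod (of_real v2 * (x - s) + of_real v1 * (x - w)))\<^sup>2 / (v1 + v2)\<^sup>2"
    unfolding cc by (simp add: norm_divide power_divide del: of_real_add)
  then have "(cmod (x - c))\<^sup>2 / (v1 * v2 / (v1 + v2))
    = (cmod (of_real v2 * (x - s) + of_real v1 * (x - w)))\<^sup>2 / (v1 * v2 * (v1 + v2))"
    by (simp add: power2_eq_square)
  moreover have "(cmod (x - s))\<^sup>2 / v1 + (cmod (w - x))\<^sup>2 / v2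
     = (cmod (w - s))\<^sup>2 / (v1 + v2)
      + (cmod (of_real v2 * (x - s) + of_real v1 * (x - w)))\<^sup>2 / (v1 * v2 * (v1 + v2))"
  proof -
    have poly: "(a\<^sup>2 * v2 + b\<^sup>2 * v1) * (v1 + v2) = (a + b)\<^sup>2 * (v1 * v2) + (v2 * a - v1 * b)\<^sup>2" for a b :: real
      by (simp add: power2_eq_square algebra_simps)
    have eq: "a\<^sup>2 / v1 + b\<^sup>2 / v2 = (a + b)\<^sup>2 / (v1 + v2) + (v2 * a - v1 * b)\<^sup>2 / (v1 * v2 * (v1 + v2))" for a b
    proof -
      have "a\<^sup>2 / v1 + b\<^sup>2 / v2 = (a\<^sup>2 * v2 + b\<^sup>2 * v1) / (v1 * v2)"
        using assms by (simp add: field_simps)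
      also have "\<dots> = ((a\<^sup>2 * v2 + b\<^sup>2 * v1) * (v1 + v2)) / (v1 * v2 * (v1 + v2))"
        using n0 by simp
      also have "\<dots> = (a + b)\<^sup>2 / (v1 + v2) + (v2 * a - v1 * b)\<^sup>2 / (v1 * v2 * (v1 + v2))"
        unfolding poly add_divide_distrib using assms n0 by simp
      finally show ?thesis .
    qed
    \<comment> \<open>In each real coordinate \<open>a = x - s\<close> and \<open>b = w - x\<close>,
      so that \<open>a + b = w - s\<close> and \<open>v2 * a - v1 * b\<close> is the numerator of
      \<open>x - c\<close>.\<close>
    show ?thesis
      using eq[of "Re x - Re s" "Re w - Re x"] eq[of "Im x - Im s" "Im w - Im x"]
      by (simp add: cmod_power2 add_divide_distrib algebra_simps)
  qed
  ultimately have "exp (- (cmod (x - s))\<^sup>2 / v1) * exp (- (cmod (w - x))\<^sup>2 / v2)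
    = exp (- (cmod (w - s))\<^sup>2 / (v1 + v2)) * exp (- (cmod (x - c))\<^sup>2 / (v1 * v2 / (v1 + v2)))"
    unfolding exp_add[symmetric] minus_divide_left[symmetric] by simp
  then have "cgauss v1 s x * cgauss v2 x w
    = exp (- (cmod (w - s))\<^sup>2 / (v1 + v2)) * exp (- (cmod (x - c))\<^sup>2 / (v1 * v2 / (v1 + v2))) / ((pi * v1) * (pi * v2))"
    unfolding cgauss_def by simp
  also have "(pi * v1) * (pi * v2) = (pi * (v1 + v2)) * (pi * (v1 * v2 / (v1 + v2)))"
    using n0 by (simp add: field_simps)
  finally show ?thesis unfolding cgauss_def c_def[symmetric] by simp
qed

lemma vgauss_mult:
  assumes "v1 > 0" "v2 > 0"
  shows "vgauss n v1 s x * vgauss n v2 x w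
    = vgauss n (v1 + v2) s w
      * vgauss n (v1 * v2 / (v1 + v2)) (\<lambda>i. (of_real v2 * s i + of_real v1 * w i) / of_real (v1 + v2)) x"
  unfolding vgauss_prod prod.distrib[symmetric] cgauss_mult[OF assms] ..

lemma pair_sigma_finite_vec: "pair_sigma_finite (vec_space n) (vec_space n)"
  by (simp add: pair_sigma_finite_def sigma_finite_vec_space)

lemma integral_convolution_fst:
  assumes "v1 > 0" "v2 > 0" "quad_bounded n \<psi>"
  shows "integrable (vec_space n \<Otimes>\<^sub>M vec_space n) (\<lambda>(x, w). vgauss n v1 s x * vgauss n v2 x w * \<psi> x)"
    "(\<integral>(x, w). vgauss n v1 s x * vgauss n v2 x w * \<psi> x \<partial>(vec_space n \<Otimes>\<^sub>M vec_space n))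
      = (\<integral>x. vgauss n v1 s x * \<psi> x \<partial>vec_space n)"
proof -
  interpret pair_sigma_finite "vec_space n" "vec_space n" by (rule pair_sigma_finite_vec)
  have [measurable]: "\<psi> \<in> borel_measurable (vec_space n)"
    using assms(3) by (rule quad_bounded_measurable)
  have m: "(\<lambda>(x, w). vgauss n v1 s x * vgauss n v2 x w * \<psi> x) \<in> borel_measurable (vec_space n \<Otimes>\<^sub>M vec_space n)"
    unfolding split_beta by measurable
  have in_w: "(\<integral>w. norm (vgauss n v1 s x * vgauss n v2 x w * \<psi> x) \<partial>vec_space n) = norm (vgauss n v1 s x * \<psi> x)" for x
  proof -
    have "(\<integral>w. norm (vgauss n v1 s x * vgauss n v2 x w * \<psi> x) \<partial>vec_space n)
       = (\<integral>w. norm (vgauss n v1 s x * \<psi> x) * vgauss n v2 x w \<partial>vec_space n)"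
      using vgauss_pos[OF assms(2)] by (simp add: abs_mult abs_of_pos mult_ac)
    then show ?thesis using integral_vgauss[OF assms(2)] by simp
  qed
  show I: "integrable (vec_space n \<Otimes>\<^sub>M vec_space n) (\<lambda>(x, w). vgauss n v1 s x * vgauss n v2 x w * \<psi> x)"
  proof (rule Fubini_integrable[OF m])
    show "integrable (vec_space n) (\<lambda>x. \<integral>w. norm (case (x, w) of (x, w) \<Rightarrow> vgauss n v1 s x * vgauss n v2 x w * \<psi> x) \<partial>vec_space n)"
      unfolding prod.case in_w using integrable_vgauss_mult[OF assms(1,3)] by (rule integrable_norm)
    show "AE x in vec_space n. integrable (vec_space n) (\<lambda>w. case (x, w) of (x, w) \<Rightarrow> vgauss n v1 s x * vgauss n v2 x w * \<psi> x)"
      using integral_vgauss[OF assms(2)] by auto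
  qed
  show "(\<integral>(x, w). vgauss n v1 s x * vgauss n v2 x w * \<psi> x \<partial>(vec_space n \<Otimes>\<^sub>M vec_space n))
      = (\<integral>x. vgauss n v1 s x * \<psi> x \<partial>vec_space n)"
    using I by (subst integral_fst'[symmetric]) (auto simp: integral_vgauss[OF assms(2)])
qed

text \<open>The integral over \<open>x\<close> is done first: after \<open>vgauss_mult\<close> the
  posterior density has mass 1, and the output density of variance \<open>v1 + v2\<close> remains.
  Convolution is thus handled through the joint density on pairs.\<close>

lemma integral_convolution_snd:
  assumes "v1 > 0" "v2 > 0" "quad_bounded n \<psi>"
  shows "integrable (vec_space n \<Otimes>\<^sub>M vec_space n) (\<lambda>(x, w). vgauss n v1 s x * vgauss n v2 x w * \<psi> w)"
    "(\<integral>(x, w). vgauss n v1 s x * vgauss n v2 x w * \<psi> w \<partial>(vec_space n \<Otimes>\<^sub>M vec_space n))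
      = (\<integral>w. vgauss n (v1 + v2) s w * \<psi> w \<partial>vec_space n)"
proof -
  interpret pair_sigma_finite "vec_space n" "vec_space n" by (rule pair_sigma_finite_vec)
  have [measurable]: "\<psi> \<in> borel_measurable (vec_space n)"
    using assms(3) by (rule quad_bounded_measurable)
  have v: "v1 + v2 > 0" "v1 * v2 / (v1 + v2) > 0" using assms by auto
  have m: "(\<lambda>(w, x). vgauss n v1 s x * vgauss n v2 x w * \<psi> w) \<in> borel_measurable (vec_space n \<Otimes>\<^sub>M vec_space n)"
    unfolding split_beta by measurable
  have in_x: "(\<integral>x. norm (vgauss n v1 s x * vgauss n v2 x w * \<psi> w) \<partial>vec_space n) = norm (vgauss n (v1 + v2) s w * \<psi> w)"
    and in_x': "(\<integral>x. vgauss n v1 s x * vgauss n v2 x w * \<psi> w \<partial>vec_space n) = vgauss n (v1 + v2) s w * \<psi> w"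
    and int_x: "integrable (vec_space n) (\<lambda>x. vgauss n v1 s x * vgauss n v2 x w * \<psi> w)" for w
    unfolding vgauss_mult[OF assms(1,2)]
    using vgauss_pos[OF v(2)] integral_vgauss[OF v(2)] by (auto simp: abs_mult abs_of_pos)
  have I': "integrable (vec_space n \<Otimes>\<^sub>M vec_space n) (\<lambda>(w, x). vgauss n v1 s x * vgauss n v2 x w * \<psi> w)"
  proof (rule Fubini_integrable[OF m])
    show "integrable (vec_space n) (\<lambda>w. \<integral>x. norm (case (w, x) of (w, x) \<Rightarrow> vgauss n v1 s x * vgauss n v2 x w * \<psi> w) \<partial>vec_space n)"
      unfolding prod.case in_x using integrable_vgauss_mult[OF v(1) assms(3)] by (rule integrable_norm)
  qed (use int_x in auto)
  show I: "integrable (vec_space n \<Otimes>\<^sub>M vec_space n) (\<lambda>(x, w). vgauss n v1 s x * vgauss n v2 x w * \<psi> w)"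
    using integrable_product_swap[OF I'] by (simp add: split_beta)
  show "(\<integral>(x, w). vgauss n v1 s x * vgauss n v2 x w * \<psi> w \<partial>(vec_space n \<Otimes>\<^sub>M vec_space n))
      = (\<integral>w. vgauss n (v1 + v2) s w * \<psi> w \<partial>vec_space n)"
    unfolding in_x'[symmetric] using integral_snd[OF I] by simp
qed

lemma mixture_convolution_fst:
  assumes "v1 > 0" "v2 > 0" "quad_bounded n \<psi>"
  shows "integrable (vec_space n \<Otimes>\<^sub>M vec_space n) (\<lambda>(x, w). mixture n v1 A s x * vgauss n v2 x w * \<psi> x)"
    "(\<integral>(x, w). mixture n v1 A s x * vgauss n v2 x w * \<psi> x \<partial>(vec_space n \<Otimes>\<^sub>M vec_space n))
      = (\<integral>x. mixture n v1 A s x * \<psi> x \<partial>vec_space n)"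
proof -
  have e: "(\<lambda>(x, w). mixture n v1 A s x * vgauss n v2 x w * \<psi> x)
    = (\<lambda>z. (\<Sum>m\<in>A. (\<lambda>(x, w). vgauss n v1 (s m) x * vgauss n v2 x w * \<psi> x) z) / real (card A))"
    by (auto simp: mixture_def sum_distrib_right)
  show "integrable (vec_space n \<Otimes>\<^sub>M vec_space n) (\<lambda>(x, w). mixture n v1 A s x * vgauss n v2 x w * \<psi> x)"
    unfolding e using integral_convolution_fst(1)[OF assms]
    by (intro integrable_divide Bochner_Integration.integrable_sum)
  show "(\<integral>(x, w). mixture n v1 A s x * vgauss n v2 x w * \<psi> x \<partial>(vec_space n \<Otimes>\<^sub>M vec_space n))
      = (\<integral>x. mixture n v1 A s x * \<psi> x \<partial>vec_space n)"
    unfolding e integral_mixture_mult(2)[OF assms(1,3)]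
    using integral_convolution_fst[OF assms] by (simp add: Bochner_Integration.integral_sum)
qed

lemma mixture_convolution_snd:
  assumes "v1 > 0" "v2 > 0" "quad_bounded n \<psi>"
  shows "integrable (vec_space n \<Otimes>\<^sub>M vec_space n) (\<lambda>(x, w). mixture n v1 A s x * vgauss n v2 x w * \<psi> w)"
    "(\<integral>(x, w). mixture n v1 A s x * vgauss n v2 x w * \<psi> w \<partial>(vec_space n \<Otimes>\<^sub>M vec_space n))
      = (\<integral>w. mixture n (v1 + v2) A s w * \<psi> w \<partial>vec_space n)"
proof -
  have e: "(\<lambda>(x, w). mixture n v1 A s x * vgauss n v2 x w * \<psi> w)
    = (\<lambda>z. (\<Sum>m\<in>A. (\<lambda>(x, w). vgauss n v1 (s m) x * vgauss n v2 x w * \<psi> w) z) / real (card A))"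
    by (auto simp: mixture_def sum_distrib_right)
  have v: "v1 + v2 > 0" using assms by simp
  show "integrable (vec_space n \<Otimes>\<^sub>M vec_space n) (\<lambda>(x, w). mixture n v1 A s x * vgauss n v2 x w * \<psi> w)"
    unfolding e using integral_convolution_snd(1)[OF assms]
    by (intro integrable_divide Bochner_Integration.integrable_sum)
  show "(\<integral>(x, w). mixture n v1 A s x * vgauss n v2 x w * \<psi> w \<partial>(vec_space n \<Otimes>\<^sub>M vec_space n))
      = (\<integral>w. mixture n (v1 + v2) A s w * \<psi> w \<partial>vec_space n)"
    unfolding e integral_mixture_mult(2)[OF v assms(3)]
    using integral_convolution_snd[OF assms] by (simp add: Bochner_Integration.integral_sum)
qed

text \<open>Chain rule for relative entropy: the joint law of input and output is compared with the
  law that keeps the true output but regenerates the input from the Gaussian posterior. That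
  divergence is the input divergence minus the output divergence, and it is nonnegative by Gibbs'
  inequality.\<close>

lemma relative_entropy_convolution_le:
  assumes "v1 > 0" "v2 > 0" "finite A" "A \<noteq> {}" "N > 0"
  shows "(\<integral>w. mixture n (v1 + v2) A s w * (ln (mixture n (v1 + v2) A s w) - ln (vgauss n (N + v2) u w)) \<partial>vec_space n)
    \<le> (\<integral>x. mixture n v1 A s x * (ln (mixture n v1 A s x) - ln (vgauss n N u x)) \<partial>vec_space n)"
proof -
  interpret pair_sigma_finite "vec_space n" "vec_space n" by (rule pair_sigma_finite_vec)
  have v: "v1 + v2 > 0" "N + v2 > 0" "N * v2 / (N + v2) > 0" using assms by auto
  let ?fV = "mixture n v1 A s" and ?fW = "mixture n (v1 + v2) A s"
  let ?gV = "vgauss n N u" and ?gW = "vgauss n (N + v2) u"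
  let ?P = "vec_space n \<Otimes>\<^sub>M vec_space n"
  let ?c = "\<lambda>w i. (of_real v2 * u i + of_real N * w i) / complex_of_real (N + v2)"
  define p where "p = (\<lambda>(x, w). ?fV x * vgauss n v2 x w)"
  \<comment> \<open>\<open>p\<close> is the joint law of input and output of the noise channel; \<open>q\<close> has the same output law
    but the reversed channel that belongs to the input law \<open>?gV\<close>.\<close>
  define q where "q = (\<lambda>(x, w). ?fW w / ?gW w * (?gV x * vgauss n v2 x w))"
  have q': "q = (\<lambda>(x, w). ?fW w * vgauss n (N * v2 / (N + v2)) (?c w) x)"
    unfolding q_def vgauss_mult[OF assms(5,2)] using vgauss_pos[OF v(2)]
    by (auto simp: fun_eq_iff dest: less_imp_neq[THEN not_sym])
  let ?dV = "\<lambda>x. ln (?fV x) - ln (?gV x)" and ?dW = "\<lambda>w. ln (?fW w) - ln (?gW w)"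
  have qbV: "quad_bounded n ?dV" and qbW: "quad_bounded n ?dW"
    using assms v by (auto intro!: quad_bounded_diff quad_bounded_ln_mixture quad_bounded_ln_vgauss)
  note pos = mixture_pos[OF assms(1,3,4), of n s] mixture_pos[OF v(1) assms(3,4), of n s]
    vgauss_pos[OF assms(2)] vgauss_pos[OF v(2)] vgauss_pos[OF assms(5)]
  note V = mixture_convolution_fst[OF assms(1,2) qbV, of A s]
  note W = mixture_convolution_snd[OF assms(1,2) qbW, of A s]
  have p_int: "integrable ?P p" "(\<integral>x. p x \<partial>?P) = 1"
    using mixture_convolution_fst[OF assms(1,2) quad_bounded_const[of n 1], of A s] integral_mixture[OF assms(1,3,4), of n s]
    by (auto simp: p_def)
  have q_int: "integrable ?P q" "(\<integral>x. q x \<partial>?P) = 1"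
  proof -
    have m: "(\<lambda>(w, x). q (x, w)) \<in> borel_measurable ?P"
      unfolding q_def prod.case split_beta by measurable
    have in_x: "(\<integral>x. norm (q (x, w)) \<partial>vec_space n) = norm (?fW w)" "(\<integral>x. q (x, w) \<partial>vec_space n) = ?fW w"
      "integrable (vec_space n) (\<lambda>x. q (x, w))" for w
      unfolding q' using vgauss_pos[OF v(3)] integral_vgauss[OF v(3)] by (auto simp: abs_mult abs_of_pos)
    have "integrable ?P (\<lambda>(w, x). q (x, w))"
      by (rule Fubini_integrable[OF m])
        (use integral_mixture[OF v(1) assms(3,4), of n s] in_x in \<open>auto intro: integrable_norm\<close>)
    from integrable_product_swap[OF this] show I: "integrable ?P q" by (simp add: split_beta)
    have "(\<integral>(x, w). q (x, w) \<partial>?P) = (\<integral>w. ?fW w \<partial>vec_space n)"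
      using integral_snd[of "\<lambda>x w. q (x, w)"] I by (simp add: in_x)
    then show "(\<integral>x. q x \<partial>?P) = 1" using integral_mixture[OF v(1) assms(3,4), of n s] by simp
  qed
  have pq_pos: "p z > 0" "q z > 0" for z
    using pos by (auto simp: p_def q_def split_beta intro!: mult_pos_pos divide_pos_pos)
  \<comment> \<open>The noise density cancels from \<open>ln q - ln p\<close>. What remains is a
    function of the output minus a function of the input, so each part is integrated against its own
    marginal.\<close>
  have e: "(\<lambda>z. p z * (ln (q z) - ln (p z)))
     = (\<lambda>z. (\<lambda>(x, w). ?fV x * vgauss n v2 x w * ?dW w) z - (\<lambda>(x, w). ?fV x * vgauss n v2 x w * ?dV x) z)"
  proof -
    have "ln (q (x, w)) - ln (p (x, w)) = ?dW w - ?dV x" for x w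
    proof -
      have "ln (q (x, w)) = ln (?fW w) - ln (?gW w) + (ln (?gV x) + ln (vgauss n v2 x w))"
        unfolding q_def prod.case using pos
        by (subst ln_mult_pos, simp_all add: ln_divide_pos ln_mult_pos)
      moreover have "ln (p (x, w)) = ln (?fV x) + ln (vgauss n v2 x w)"
        unfolding p_def prod.case using pos by (simp add: ln_mult_pos)
      ultimately show ?thesis by simp
    qed
    then show ?thesis
      by (auto simp: fun_eq_iff p_def split_beta simp flip: right_diff_distrib)
  qed
  have "(\<integral>z. p z * (ln (q z) - ln (p z)) \<partial>?P) \<le> (\<integral>x. q x \<partial>?P) - (\<integral>x. p x \<partial>?P)"
  proof (rule gibbs_inequality)
    show "integrable ?P (\<lambda>z. p z * (ln (q z) - ln (p z)))"
      unfolding e using V W by (intro Bochner_Integration.integrable_diff)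
  qed (use p_int q_int pq_pos in auto)
  then have "(\<integral>z. p z * (ln (q z) - ln (p z)) \<partial>?P) \<le> 0" by (simp add: p_int q_int)
  then show ?thesis
    unfolding e Bochner_Integration.integral_diff[OF W(1) V(1)] V(2) W(2) by simp
qed

text \<open>Relative entropy to a Gaussian is minus the entropy plus a cross entropy that depends on
  the second moment only. Bounding that moment by \<open>real n * N\<close> makes the quadratic
  terms change in the favourable direction, so the entropies obey the bound that is exact for
  Gaussians.\<close>

lemma diff_entropy_convolution_le:
  assumes "v1 > 0" "v2 > 0" "finite A" "A \<noteq> {}" "N > 0"
    and N: "real n * v1 + (\<Sum>m\<in>A. sq_dist n (s m) u) / real (card A) \<le> real n * N"
  shows "diff_entropy n (mixture n v1 A s) - diff_entropy n (mixture n (v1 + v2) A s)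
    \<le> real n * ln (N / (N + v2))"
proof -
  define k where "k = (\<Sum>m\<in>A. sq_dist n (s m) u) / real (card A)"
  have v: "v1 + v2 > 0" "N + v2 > 0" using assms by auto
  have c: "card A > 0" using assms by (auto simp: card_gt_0_iff)
  have D: "(\<integral>w. mixture n v A s w * (ln (mixture n v A s w) - ln (vgauss n M u w)) \<partial>vec_space n)
    = - diff_entropy n (mixture n v A s) + (real n * v + k) / M + real n * ln (pi * M)"
    if vM: "v > 0" "M > 0" for v M
  proof -
    let ?f = "mixture n v A s"
    note qb = quad_bounded_ln_mixture[OF vM(1) assms(3,4), of n s]
    have "(\<integral>y. ?f y * (ln (?f y) - ln (vgauss n M u y)) \<partial>vec_space n)
     = (\<integral>y. ?f y * ln (?f y) + ((1 / M) * (?f y * sq_dist n y u) + (real n * ln (pi * M)) * ?f y) \<partial>vec_space n)"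
      by (rule Bochner_Integration.integral_cong) (use vM in \<open>auto simp: ln_vgauss field_simps\<close>)
    also have "\<dots> = - diff_entropy n ?f + ((1 / M) * (\<integral>y. ?f y * sq_dist n y u \<partial>vec_space n) + real n * ln (pi * M))"
      unfolding diff_entropy_def
      using integral_mixture[OF vM(1) assms(3,4), of n s] integral_mixture_mult(1)[OF vM(1) quad_bounded_sq_dist[of n u], of A s]
        integral_mixture_mult(1)[OF vM(1) qb, of A s]
      by simp
    also have "(\<integral>y. ?f y * sq_dist n y u \<partial>vec_space n) = real n * v + k"
      using integral_mixture_mult(2)[OF vM(1) quad_bounded_sq_dist[of n u], of A s] c vM(1)
      by (simp add: integral_vgauss_sq sum.distrib add_divide_distrib k_def)
    finally show ?thesis by simp
  qed
  \<comment> \<open>Adding \<open>real n * v2\<close> above and \<open>v2\<close> below moves the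
    quotient towards \<open>real n\<close>, and by \<open>N\<close> it starts at or below that
    value.\<close>
  have "(real n * v1 + k) / N \<le> (real n * (v1 + v2) + k) / (N + v2)"
  proof -
    have "(real n * v1 + k) * v2 \<le> real n * N * v2" using N assms(2) by (intro mult_right_mono) (auto simp: k_def)
    then have "(real n * v1 + k) * (N + v2) \<le> (real n * (v1 + v2) + k) * N" by (simp add: algebra_simps)
    then show ?thesis using assms v by (simp add: field_simps)
  qed
  moreover have "real n * ln (N / (N + v2)) = real n * ln (pi * N) - real n * ln (pi * (N + v2))"
  proof -
    have "ln (N / (N + v2)) = ln (pi * N) - ln (pi * (N + v2))"
      using ln_divide_pos[of N "N + v2"] ln_mult_pos[of pi N] ln_mult_pos[of pi "N + v2"] assms v by simp
    then show ?thesis by (simp add: right_diff_distrib)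
  qed
  ultimately show ?thesis
    using relative_entropy_convolution_le[OF assms(1-5), of n s u] D[OF assms(1,5)] D[OF v] by linarith
qed

text \<open>The signal amplified by \<open>sqrt b\<close> in noise of variance \<open>1 + (b - 1)\<close> is a scaled copy of the
  original output, so amplification is undone by adding noise.\<close>

lemma diff_entropy_gain_le:
  assumes "b > 1" "finite A" "A \<noteq> {}"
    and P: "(\<Sum>m\<in>A. sq_dist n (s m) u) / real (card A) \<le> real n * P" and "P \<ge> 0"
  shows "diff_entropy n (mixture n 1 A (\<lambda>m i. complex_of_real (sqrt b) * s m i)) - diff_entropy n (mixture n 1 A s)
    \<le> real n * ln ((1 + b * P) / (1 + P))"
proof -
  let ?s = "\<lambda>m i. complex_of_real (sqrt b) * s m i"
  have c: "card A > 0" using assms by (auto simp: card_gt_0_iff)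
  have sq: "sq_dist n (?s m) (\<lambda>i. of_real (sqrt b) * u i) = b * sq_dist n (s m) u" for m
    using assms(1) by (simp add: sq_dist_def sum_distrib_left norm_mult power_mult_distrib flip: right_diff_distrib)
  \<comment> \<open>With \<open>P\<close> as power bound the amplified output has variance at most
    \<open>1 + b * P\<close>; adding \<open>b - 1\<close> gives \<open>b * (1 + P)\<close>, the
    corresponding value for \<open>sqrt b\<close> times the original output.\<close>
  have "diff_entropy n (mixture n 1 A ?s) - diff_entropy n (mixture n (1 + (b - 1)) A ?s)
    \<le> real n * ln ((1 + b * P) / ((1 + b * P) + (b - 1)))"
  proof (rule diff_entropy_convolution_le)
    have "b * ((\<Sum>m\<in>A. sq_dist n (s m) u) / real (card A)) \<le> b * (real n * P)"
      using P assms by (intro mult_left_mono) auto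
    then show "real n * 1 + (\<Sum>m\<in>A. sq_dist n (?s m) (\<lambda>i. of_real (sqrt b) * u i)) / real (card A) \<le> real n * (1 + b * P)"
      unfolding sq by (simp add: algebra_simps flip: sum_distrib_left)
  qed (use assms in \<open>auto intro: add_pos_nonneg\<close>)
  moreover have "diff_entropy n (mixture n (1 + (b - 1)) A ?s) = diff_entropy n (mixture n 1 A s) + real n * ln b"
    using diff_entropy_affine[of 1 "sqrt b" A n "\<lambda>_. 0" s] assms by (simp add: ln_sqrt)
  moreover have "real n * ln ((1 + b * P) / ((1 + b * P) + (b - 1)))
      = real n * ln ((1 + b * P) / (1 + P)) - real n * ln b"
  proof -
    have "(1 + b * P) / ((1 + b * P) + (b - 1)) = ((1 + b * P) / (1 + P)) / b"
      using assms by (simp add: field_simps)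
    moreover have "ln (((1 + b * P) / (1 + P)) / b) = ln ((1 + b * P) / (1 + P)) - ln b"
      using assms by (intro ln_divide_pos divide_pos_pos add_pos_nonneg mult_nonneg_nonneg) auto
    ultimately show ?thesis by (simp only: right_diff_distrib)
  qed
  ultimately show ?thesis by linarith
qed

section \<open>Fano's inequality\<close>

text \<open>In a pair, \<open>w\<close> is the message tuple to be decoded and \<open>b\<close> the
  one that stays as interference; \<open>mixture n v B (s w)\<close> is the output law given
  \<open>w\<close>.\<close>

lemma mixture_times:
  "mixture n v (A \<times> B) (\<lambda>(w, b). s w b) y = (\<Sum>w\<in>A. mixture n v B (s w) y) / real (card A)"
  by (simp add: mixture_def sum.cartesian_product split_beta' sum_divide_distrib[symmetric] card_cartesian_product mult.commute)

lemma diff_entropy_mixture_times: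
  assumes "v > 0" "finite A" "A \<noteq> {}" "finite B" "B \<noteq> {}"
  shows "diff_entropy n (mixture n v (A \<times> B) (\<lambda>(w, b). s w b))
    = - (\<Sum>w\<in>A. \<integral>y. mixture n v B (s w) y * ln (mixture n v (A \<times> B) (\<lambda>(w, b). s w b) y) \<partial>vec_space n) / real (card A)"
proof -
  let ?f = "mixture n v (A \<times> B) (\<lambda>(w, b). s w b)"
  have qb: "quad_bounded n (\<lambda>y. ln (?f y))"
    using assms by (intro quad_bounded_ln_mixture) auto
  have "(\<integral>y. ?f y * ln (?f y) \<partial>vec_space n)
     = (\<integral>y. (\<Sum>w\<in>A. mixture n v B (s w) y * ln (?f y)) / real (card A) \<partial>vec_space n)"
    by (subst (1) mixture_times) (simp add: sum_distrib_right)
  also have "\<dots> = (\<Sum>w\<in>A. \<integral>y. mixture n v B (s w) y * ln (?f y) \<partial>vec_space n) / real (card A)"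
    unfolding integral_divide_zero using integral_mixture_mult(1)[OF assms(1) qb]
    by (subst Bochner_Integration.integral_sum) auto
  finally show ?thesis by (simp add: diff_entropy_def)
qed

text \<open>The mixture is at least \<open>1 / card A\<close> times each component, so learning
  \<open>w\<close> lowers the entropy by at most \<open>ln (card A)\<close>.\<close>

lemma diff_entropy_mixture_times_le:
  assumes "v > 0" "finite A" "A \<noteq> {}" "finite B" "B \<noteq> {}"
  shows "diff_entropy n (mixture n v (A \<times> B) (\<lambda>(w, b). s w b))
    \<le> ln (card A) + (\<Sum>w\<in>A. diff_entropy n (mixture n v B (s w))) / real (card A)"
proof -
  let ?f = "mixture n v (A \<times> B) (\<lambda>(w, b). s w b)"
  let ?g = "\<lambda>w. mixture n v B (s w)"
  have c: "real (card A) > 0" using assms by (auto simp: card_gt_0_iff)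
  have qb: "quad_bounded n (\<lambda>y. ln (?f y))" and qg: "\<And>w. quad_bounded n (\<lambda>y. ln (?g w y))"
    using assms by (auto intro!: quad_bounded_ln_mixture)
  have "- (\<integral>y. ?g w y * ln (?f y) \<partial>vec_space n) \<le> ln (card A) + diff_entropy n (?g w)" if w: "w \<in> A" for w
  proof -
    have "ln (?g w y) - ln (card A) \<le> ln (?f y)" for y
    proof -
      have "?g w y \<le> (\<Sum>w\<in>A. ?g w y)"
        using w assms mixture_pos[OF assms(1,4,5)] by (intro member_le_sum) (auto intro: less_imp_le)
      then have "?g w y / card A \<le> ?f y"
        unfolding mixture_times using c by (intro divide_right_mono) auto
      then have "ln (?g w y / card A) \<le> ln (?f y)"
        using c mixture_pos[OF assms(1,4,5)] by (intro ln_mono) auto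
      then show ?thesis using c mixture_pos[OF assms(1,4,5), of n "s w" y] by (simp add: ln_divide_pos)
    qed
    then have "(\<integral>y. ?g w y * (ln (?g w y) - ln (card A)) \<partial>vec_space n) \<le> (\<integral>y. ?g w y * ln (?f y) \<partial>vec_space n)"
      using mixture_pos[OF assms(1,4,5), of n "s w"]
      by (intro integral_mono integral_mixture_mult(1)[OF assms(1)] qb quad_bounded_diff qg quad_bounded_const
          mult_left_mono) (auto intro: less_imp_le)
    then show ?thesis
      using integral_mixture_mult(1)[OF assms(1) qg[of w], of B "s w"] integral_mixture[OF assms(1,4,5), of n "s w"]
      by (simp add: right_diff_distrib diff_entropy_def)
  qed
  then have "(\<Sum>w\<in>A. - (\<integral>y. ?g w y * ln (?f y) \<partial>vec_space n)) \<le> (\<Sum>w\<in>A. ln (card A) + diff_entropy n (?g w))"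
    by (intro sum_mono)
  then have "(\<Sum>w\<in>A. - (\<integral>y. ?g w y * ln (?f y) \<partial>vec_space n)) / real (card A)
     \<le> (real (card A) * ln (card A) + (\<Sum>w\<in>A. diff_entropy n (?g w))) / real (card A)"
    using c by (intro divide_right_mono) (auto simp: sum.distrib)
  then show ?thesis
    unfolding diff_entropy_mixture_times[OF assms] using c by (simp add: sum_negf add_divide_distrib)
qed

text \<open>The left side is the equivocation of \<open>w\<close> given the output. It is at most
  the expected cost of describing \<open>w\<close> by a guessed posterior; the guess below costs at
  most \<open>ln 2\<close> when the decoder is right and \<open>ln 2 + ln (card A)\<close> when it
  is wrong.\<close>

lemma fano_mixture:
  assumes "v > 0" "finite A" "A \<noteq> {}" "finite B" "B \<noteq> {}"
    and D: "D \<in> measurable (vec_space n) (count_space UNIV)"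
  shows "ln (card A) + (\<Sum>w\<in>A. diff_entropy n (mixture n v B (s w))) / real (card A)
      - diff_entropy n (mixture n v (A \<times> B) (\<lambda>(w, b). s w b))
    \<le> ln 2 + ln (card A) * ((\<Sum>w\<in>A. \<integral>y. mixture n v B (s w) y * of_bool (D y \<noteq> w) \<partial>vec_space n) / real (card A))"
proof -
  let ?f = "mixture n v (A \<times> B) (\<lambda>(w, b). s w b)"
  let ?g = "\<lambda>w. mixture n v B (s w)"
  define a where "a = real (card A)"
  have c: "a > 0" "a \<ge> 1" using assms by (auto simp: a_def card_gt_0_iff Suc_le_eq)
  \<comment> \<open>A guess of the posterior law of \<open>w\<close>: half the mass on the estimate, half spread uniformly.\<close>
  define r where "r = (\<lambda>w y. of_bool (D y = w) / 2 + 1 / (2 * a))"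
  have rpos: "r w y > 0" for w y using c by (simp add: r_def add_nonneg_pos)
  have Dm[measurable]: "Measurable.pred (vec_space n) (\<lambda>y. D y = w)" for w
    by (rule measurable_compose[OF D]) simp
  have rb: "quad_bounded n (r w)" "quad_bounded n (\<lambda>y. ln (r w y))" "quad_bounded n (\<lambda>y. of_bool (D y \<noteq> w))" for w
  proof -
    have le: "r w y \<le> 1" "1 / (2 * a) \<le> r w y" for y using c by (auto simp: r_def field_simps)
    show "quad_bounded n (r w)"
      by (rule quad_boundedI[where a = 1 and b = 0])
        (use rpos le in \<open>auto simp: abs_of_pos, auto simp: r_def\<close>)
    have "\<bar>ln (r w y)\<bar> \<le> - ln (1 / (2 * a))" for y
      using ln_mono[OF le(2)[of y]] ln_mono[OF le(1)[of y] rpos] c by (auto simp: abs_if)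
    moreover have "0 \<le> - ln (1 / (2 * a))" using c by (simp add: ln_div)
    ultimately show "quad_bounded n (\<lambda>y. ln (r w y))"
      by (intro quad_boundedI[where a = "- ln (1 / (2 * a))" and b = 0]) (auto simp: r_def)
    show "quad_bounded n (\<lambda>y. of_bool (D y \<noteq> w))"
      by (rule quad_boundedI[where a = 1 and b = 0]) auto
  qed
  have qf: "quad_bounded n (\<lambda>y. ln (?f y))" and qg: "\<And>w. quad_bounded n (\<lambda>y. ln (?g w y))"
    using assms by (auto intro!: quad_bounded_ln_mixture)
  have AB: "finite (A \<times> B)" "A \<times> B \<noteq> {}" using assms by auto
  note gpos = mixture_pos[OF assms(1,4,5)] and fpos = mixture_pos[OF assms(1) AB]
  note gi = integral_mixture_mult(1)[OF assms(1)]
  have step: "(\<integral>y. ?g w y * ln (?f y) \<partial>vec_space n) + diff_entropy n (?g w) + ln a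
      - (ln 2 + ln a * (\<integral>y. ?g w y * of_bool (D y \<noteq> w) \<partial>vec_space n))
    \<le> a * (\<integral>y. ?f y * r w y \<partial>vec_space n) - 1" if "w \<in> A" for w
  proof -
    \<comment> \<open>\<open>?p\<close> is the joint density of message \<open>w\<close> and output,
      \<open>?q\<close> the output density times the guessed posterior. Gibbs' inequality is applied
      per message, and the masses are compared only after summing over \<open>A\<close>.\<close>
    let ?p = "\<lambda>y. ?g w y / a" and ?q = "\<lambda>y. ?f y * r w y"
    have lnq: "ln (?q y) - ln (?p y) = ln (?f y) + ln (r w y) - ln (?g w y) + ln a" for y
      using gpos fpos rpos c by (simp add: ln_mult_pos ln_divide_pos)
    have le: "?g w y * (ln (?f y) - ln (?g w y) + ln a - ln 2 - ln a * of_bool (D y \<noteq> w)) / a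
       \<le> ?p y * (ln (?q y) - ln (?p y))" for y
    proof -
      have "ln (r w y) \<ge> - ln 2 - ln a * of_bool (D y \<noteq> w)"
      proof (cases "D y = w")
        case True
        have "ln (1 / 2) \<le> ln (r w y)" using c True by (intro ln_mono) (auto simp: r_def)
        then show ?thesis using True by (simp add: ln_div)
      next
        case False
        then show ?thesis using c by (simp add: r_def ln_divide_pos ln_mult_pos)
      qed
      then have "ln (?f y) - ln (?g w y) + ln a - ln 2 - ln a * of_bool (D y \<noteq> w) \<le> ln (?q y) - ln (?p y)"
        unfolding lnq by simp
      then have "?p y * (ln (?f y) - ln (?g w y) + ln a - ln 2 - ln a * of_bool (D y \<noteq> w)) \<le> ?p y * (ln (?q y) - ln (?p y))"
        using gpos c by (intro mult_left_mono) (auto intro: less_imp_le)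
      then show ?thesis by simp
    qed
    have qb1: "quad_bounded n (\<lambda>y. ln (?q y) - ln (?p y))"
      unfolding lnq by (intro quad_bounded_add quad_bounded_diff qf qg rb quad_bounded_const)
    have qb2: "quad_bounded n (\<lambda>y. ln (?f y) - ln (?g w y) + ln a - ln 2 - ln a * of_bool (D y \<noteq> w))"
      by (intro quad_bounded_add quad_bounded_diff quad_bounded_cmult qf qg rb quad_bounded_const)
    have ip: "integrable (vec_space n) (\<lambda>y. ?p y * (ln (?q y) - ln (?p y)))"
      using integrable_divide[OF gi[OF qb1, of B "s w"], of a] by simp
    have il: "integrable (vec_space n) (\<lambda>y. ?g w y * (ln (?f y) - ln (?g w y) + ln a - ln 2 - ln a * of_bool (D y \<noteq> w)) / a)"
      using integrable_divide[OF gi[OF qb2, of B "s w"], of a] by simp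
    have "(\<integral>y. ?g w y * (ln (?f y) - ln (?g w y) + ln a - ln 2 - ln a * of_bool (D y \<noteq> w)) / a \<partial>vec_space n)
      \<le> (\<integral>y. ?p y * (ln (?q y) - ln (?p y)) \<partial>vec_space n)"
      using le by (intro integral_mono il ip)
    also have "\<dots> \<le> (\<integral>y. ?q y \<partial>vec_space n) - (\<integral>y. ?p y \<partial>vec_space n)"
      by (rule gibbs_inequality)
        (use integral_mixture[OF assms(1,4,5), of n "s w"] gi[OF rb(1)] gpos fpos rpos c ip in auto)
    also have "(\<integral>y. ?p y \<partial>vec_space n) = 1 / a"
      using integral_mixture[OF assms(1,4,5), of n "s w"] by simp
    finally have "(\<integral>y. ?g w y * (ln (?f y) - ln (?g w y) + ln a - ln 2 - ln a * of_bool (D y \<noteq> w)) \<partial>vec_space n)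
       \<le> a * (\<integral>y. ?q y \<partial>vec_space n) - 1"
      using c by (simp add: field_simps)
    moreover have "(\<integral>y. ?g w y * (ln (?f y) - ln (?g w y) + ln a - ln 2 - ln a * of_bool (D y \<noteq> w)) \<partial>vec_space n)
      = (\<integral>y. ?g w y * ln (?f y) - ?g w y * ln (?g w y) + (ln a - ln 2) * ?g w y - ln a * (?g w y * of_bool (D y \<noteq> w)) \<partial>vec_space n)"
      by (rule Bochner_Integration.integral_cong) (auto simp: algebra_simps)
    moreover have "\<dots> = (\<integral>y. ?g w y * ln (?f y) \<partial>vec_space n) + diff_entropy n (?g w) + (ln a - ln 2)
        - ln a * (\<integral>y. ?g w y * of_bool (D y \<noteq> w) \<partial>vec_space n)"
      unfolding diff_entropy_def
      using gi[OF qf, of B "s w"] gi[OF qg[of w], of B "s w"] gi[OF rb(3)[of w], of B "s w"]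
        integral_mixture[OF assms(1,4,5), of n "s w"]
      by simp
    ultimately show ?thesis by simp
  qed
  \<comment> \<open>An estimate outside \<open>A\<close> wastes half of the mass, so the guesses sum
    to at most 1, not always to 1.\<close>
  have r_sum: "(\<Sum>w\<in>A. r w y) \<le> 1" for y
  proof -
    have "(\<Sum>w\<in>A. of_bool (D y = w) :: real) \<le> 1"
      using assms(2) by (simp add: of_bool_def sum.delta)
    then show ?thesis
      using c by (simp add: r_def sum.distrib sum_divide_distrib[symmetric] a_def)
  qed
  have "(\<Sum>w\<in>A. a * (\<integral>y. ?f y * r w y \<partial>vec_space n) - 1) \<le> 0"
  proof -
    have "(\<Sum>w\<in>A. \<integral>y. ?f y * r w y \<partial>vec_space n) = (\<integral>y. ?f y * (\<Sum>w\<in>A. r w y) \<partial>vec_space n)"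
      unfolding sum_distrib_left using gi[OF rb(1)]
      by (subst Bochner_Integration.integral_sum) auto
    also have "\<dots> \<le> (\<integral>y. ?f y \<partial>vec_space n)"
    proof (rule integral_mono)
      show "integrable (vec_space n) (\<lambda>y. ?f y * (\<Sum>w\<in>A. r w y))"
        unfolding sum_distrib_left using gi[OF rb(1)] by (intro Bochner_Integration.integrable_sum)
      fix y show "?f y * (\<Sum>w\<in>A. r w y) \<le> ?f y"
        using mult_left_mono[OF r_sum[of y], of "?f y"] fpos by (simp add: less_imp_le)
    qed (use integral_mixture[OF assms(1) AB] in auto)
    also have "\<dots> = 1" using integral_mixture[OF assms(1) AB] by simp
    finally have "a * (\<Sum>w\<in>A. \<integral>y. ?f y * r w y \<partial>vec_space n) \<le> a * 1" using c by (intro mult_left_mono) auto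
    then show ?thesis by (simp add: sum_subtractf a_def sum_distrib_left)
  qed
  with sum_mono[of A, OF step]
  have "(\<Sum>w\<in>A. (\<integral>y. ?g w y * ln (?f y) \<partial>vec_space n) + diff_entropy n (?g w) + ln a
      - (ln 2 + ln a * (\<integral>y. ?g w y * of_bool (D y \<noteq> w) \<partial>vec_space n))) \<le> 0"
    by (rule order_trans)
  then have "(\<Sum>w\<in>A. \<integral>y. ?g w y * ln (?f y) \<partial>vec_space n) + (\<Sum>w\<in>A. diff_entropy n (?g w)) + a * ln a
      \<le> a * ln 2 + ln a * (\<Sum>w\<in>A. \<integral>y. ?g w y * of_bool (D y \<noteq> w) \<partial>vec_space n)"
    by (simp add: sum.distrib sum_subtractf a_def sum_distrib_left)
  then have "((\<Sum>w\<in>A. \<integral>y. ?g w y * ln (?f y) \<partial>vec_space n) + (\<Sum>w\<in>A. diff_entropy n (?g w)) + a * ln a) / a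
      \<le> (a * ln 2 + ln a * (\<Sum>w\<in>A. \<integral>y. ?g w y * of_bool (D y \<noteq> w) \<partial>vec_space n)) / a"
    using c by (intro divide_right_mono) auto
  then show ?thesis
    unfolding diff_entropy_mixture_times[OF assms(1-5)] a_def[symmetric]
    using c by (simp add: add_divide_distrib)
qed

section \<open>Entropy of the channel output\<close>

text \<open>The default 0 matches the one of \<open>Pi_pmf\<close> in
  \<open>message_noise_space\<close>; with it a tuple is determined by its entries in
  \<open>W\<close>, so tuples can be counted.\<close>

definition messages :: "nat \<Rightarrow> real ^ 'k \<Rightarrow> 'k set \<Rightarrow> ('k \<Rightarrow> nat) set" where
  "messages n R W = PiE_dflt W 0 (\<lambda>l. message_set n (R $ l))"

definition signal :: "'k set \<Rightarrow> ('k \<Rightarrow> complex) \<Rightarrow> 'k code_sequence \<Rightarrow> nat \<Rightarrow> ('k \<Rightarrow> nat) \<Rightarrow> nat \<Rightarrow> complex" where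
  "signal L h c n m i = (\<Sum>l\<in>L. h l * c n l (m l) i)"

definition output_entropy :: "nat \<Rightarrow> real ^ 'k \<Rightarrow> 'k set \<Rightarrow> ('k \<Rightarrow> complex) \<Rightarrow> 'k code_sequence \<Rightarrow> real" where
  "output_entropy n R L h c = diff_entropy n (mixture n 1 (messages n R L) (signal L h c n))"

section \<open>Counting messages\<close>

lemma finite_message_set [simp]: "finite (message_set n r)"
  by (simp add: message_set_def)

lemma card_message_set_ge: "2 powr (real n * r) \<le> real (card (message_set n r))"
  by (simp add: message_set_def)

lemma message_set_nonempty [simp]: "message_set n r \<noteq> {}"
proof -
  have "0 < real (card (message_set n r))"
    using card_message_set_ge[of n r] powr_gt_zero[of 2 "real n * r"] by linarith
  then show ?thesis by auto
qed

lemma finite_messages [simp]: "finite (messages n R (W :: 'k::finite set))"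
  unfolding messages_def by (intro finite_PiE_dflt) auto

lemma messages_nonempty [simp]: "messages n R W \<noteq> {}"
  by (simp add: messages_def)

lemma card_messages: "card (messages n R (W :: 'k::finite set)) = (\<Prod>l\<in>W. card (message_set n (R $ l)))"
  unfolding messages_def by (intro card_PiE_dflt) auto

lemma card_messages_pos: "card (messages n R (W :: 'k::finite set)) > 0"
  by (simp add: card_gt_0_iff)

lemma ln_card_messages:
  "ln (card (messages n R (W :: 'k::finite set))) = (\<Sum>l\<in>W. ln (card (message_set n (R $ l))))"
  unfolding card_messages of_nat_prod by (intro ln_prod) (auto simp: card_gt_0_iff)

lemma ln_card_messages_ge:
  "real n * ln 2 * (\<Sum>l\<in>W. R $ l) \<le> ln (card (messages n R (W :: 'k::finite set)))"
proof -
  have "real n * ln 2 * R $ l \<le> ln (card (message_set n (R $ l)))" for l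
  proof -
    have "ln (2 powr (real n * R $ l)) \<le> ln (card (message_set n (R $ l)))"
      using card_message_set_ge by (intro ln_mono) auto
    then show ?thesis by (simp add: ln_powr mult_ac)
  qed
  then show ?thesis unfolding ln_card_messages sum_distrib_left by (intro sum_mono)
qed

text \<open>For a nonnegative rate \<open>r\<close> the number \<open>2 powr (real n * r)\<close> is
  at least 1, so rounding it up at most doubles it: one bit per message for the whole block.\<close>

lemma ln_card_messages_le:
  assumes "\<And>l. l \<in> W \<Longrightarrow> 0 \<le> R $ l"
  shows "ln (card (messages n R (W :: 'k::finite set))) \<le> real n * ln 2 * (\<Sum>l\<in>W. R $ l) + real (card W) * ln 2"
proof -
  have "ln (card (message_set n (R $ l))) \<le> real n * ln 2 * R $ l + ln 2" if "l \<in> W" for l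
  proof -
    have 1: "1 \<le> 2 powr (real n * R $ l)" using assms[OF that] by (simp add: ge_one_powr_ge_zero)
    have "real (card (message_set n (R $ l))) \<le> 2 powr (real n * R $ l) + 1"
      using of_int_ceiling_le_add_one[of "2 powr (real n * R $ l)"] by (simp add: message_set_def)
    also have "\<dots> \<le> 2 powr (real n * R $ l) * 2" using 1 by simp
    finally have "ln (card (message_set n (R $ l))) \<le> ln (2 powr (real n * R $ l) * 2)"
      by (intro ln_mono) (auto simp: card_gt_0_iff)
    then show ?thesis by (simp add: ln_mult_pos ln_powr mult_ac)
  qed
  then have "(\<Sum>l\<in>W. ln (card (message_set n (R $ l)))) \<le> (\<Sum>l\<in>W. real n * ln 2 * R $ l + ln 2)"
    by (intro sum_mono)
  then show ?thesis unfolding ln_card_messages by (simp add: sum.distrib sum_distrib_left)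
qed

section \<open>Splitting message tuples and signals\<close>

lemma bij_betw_messages:
  assumes "W \<inter> V = {}"
  shows "bij_betw (\<lambda>(w, b) x. if x \<in> W then w x else b x) (messages n R W \<times> messages n R V) (messages n R (W \<union> V))"
proof (rule bij_betw_byWitness[where f' = "\<lambda>m. (\<lambda>x. if x \<in> W then m x else 0, \<lambda>x. if x \<in> V then m x else 0)"])
qed (use assms in \<open>auto simp: messages_def PiE_dflt_def fun_eq_iff split: if_splits\<close>)

lemma sum_messages_union:
  assumes "W \<inter> V = {}"
  shows "(\<Sum>m\<in>messages n R (W \<union> V). F m)
    = (\<Sum>(w, b)\<in>messages n R W \<times> messages n R V. F (\<lambda>x. if x \<in> W then w x else b x))"
  using sum.reindex_bij_betw[OF bij_betw_messages[OF assms], of F n R] by (simp add: split_beta)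

lemma card_messages_union:
  "W \<inter> V = {} \<Longrightarrow> card (messages n R (W \<union> V)) = card (messages n R W \<times> messages n R V)"
  using bij_betw_same_card[OF bij_betw_messages] by metis

lemma signal_union:
  assumes "W \<inter> V = {}"
  shows "signal (W \<union> V) h c n (\<lambda>x. if x \<in> W then w x else b x) i
    = signal W h c n w i + signal (V :: 'k::finite set) h c n b i"
proof -
  have "(\<Sum>l\<in>V. h l * c n l (if l \<in> W then w l else b l) i) = (\<Sum>l\<in>V. h l * c n l (b l) i)"
    using assms by (intro sum.cong) auto
  then show ?thesis unfolding signal_def using assms by (subst sum.union_disjoint) auto
qed

lemma mixture_messages:
  assumes "W \<inter> V = {}"
  shows "mixture n 1 (messages n R (W \<union> V)) (signal (W \<union> V) h c n)
    = mixture n 1 (messages n R W \<times> messages n R (V :: 'k::finite set))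
        (\<lambda>(w, b) i. signal W h c n w i + signal V h c n b i)"
  unfolding mixture_def card_messages_union[OF assms] sum_messages_union[OF assms]
  by (simp add: split_beta signal_union[OF assms, abs_def] cong: sum.cong)

lemma diff_entropy_translate:
  assumes "finite A" "A \<noteq> {}"
  shows "diff_entropy n (mixture n 1 A (\<lambda>m i. t i + s m i)) = diff_entropy n (mixture n 1 A s)"
  using diff_entropy_affine[of 1 1 A n t s] assms by simp

text \<open>Given the messages of \<open>W\<close>, the output is a translate of the output with
  only \<open>V\<close> active, and translation does not change entropy.\<close>

lemma output_entropy_le:
  assumes "W \<inter> V = {}"
  shows "output_entropy n R (W \<union> V) h c \<le> ln (card (messages n R W)) + output_entropy n R (V :: 'k::finite set) h c"
  using diff_entropy_mixture_times_le[of 1 "messages n R W" "messages n R V" n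
      "\<lambda>w b i. signal W h c n w i + signal V h c n b i"] card_messages_pos[of n R W]
  unfolding output_entropy_def mixture_messages[OF assms]
  by (simp add: diff_entropy_translate split_beta)

text \<open>Lets a channel with few transmitters be regarded as one with many: the extra ones still
  draw messages but are switched off by gain 0.\<close>

lemma output_entropy_zero_gain:
  assumes "W \<inter> V = {}" "\<And>l. l \<in> W \<Longrightarrow> h l = 0"
  shows "output_entropy n R (W \<union> V) h c = output_entropy n R (V :: 'k::finite set) h c"
proof -
  have "mixture n 1 (messages n R (W \<union> V)) (signal (W \<union> V) h c n) y = mixture n 1 (messages n R V) (signal V h c n) y" for y
  proof -
    have "signal W h c n w i = 0" for w i using assms(2) by (simp add: signal_def)
    then show ?thesis
      unfolding mixture_messages[OF assms(1)]
      using mixture_times[of n 1 "messages n R W" "messages n R V" "\<lambda>w b i. signal V h c n b i" y] card_messages_pos[of n R W]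
      by (simp add: split_beta)
  qed
  then show ?thesis unfolding output_entropy_def by presburger
qed

lemma output_entropy_cong:
  assumes "\<And>l. l \<in> L \<Longrightarrow> h l = h' l"
  shows "output_entropy n R L h c = output_entropy n R L h' c"
proof -
  have "signal L h c n = signal L h' c n" using assms by (auto simp: signal_def fun_eq_iff intro!: sum.cong)
  then show ?thesis by (simp add: output_entropy_def)
qed

lemma output_entropy_empty: "output_entropy n R {} h c = real n * ln pi + real n"
proof -
  have "messages n R {} = {\<lambda>_. 0}" by (auto simp: messages_def PiE_dflt_def)
  then have "mixture n 1 (messages n R {}) (signal {} h c n) = vgauss n 1 (\<lambda>_. 0)"
    by (auto simp: mixture_def signal_def[abs_def])
  then show ?thesis by (simp add: output_entropy_def diff_entropy_vgauss)
qed

text \<open>Replaces the product of message and noise spaces by a finite average of integrals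
  against Gaussian densities: for a fixed tuple the noise density is translated to the
  signal.\<close>

lemma error_prob_eq:
  assumes d: "d n j \<in> measurable (vec_space n) (count_space UNIV)"
  shows "error_prob n R (L :: 'k::finite set) h c j d
    = (\<Sum>m\<in>messages n R L. \<integral>y. vgauss n 1 (signal L h c n m) y * of_bool (d n j y \<noteq> m j) \<partial>vec_space n)
      / real (card (messages n R L))"
proof -
  let ?P = "pmf_of_set (messages n R L)"
  let ?T = "\<lambda>m z. channel_output n L h c m z"
  let ?M = "message_noise_space n R L"
  have P: "Pi_pmf L 0 (\<lambda>l. pmf_of_set (message_set n (R $ l))) = ?P"
    unfolding messages_def by (intro Pi_pmf_of_set) auto
  have M: "?M = measure_pmf ?P \<Otimes>\<^sub>M noise_measure n"
    unfolding message_noise_space_def P ..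
  interpret N: prob_space "noise_measure n"
    unfolding noise_measure_def by (intro prob_space_PiM prob_space_std_complex_gaussian)
  interpret PN: pair_prob_space "measure_pmf ?P" "noise_measure n" ..
  have sN: "sets (noise_measure n) = sets (vec_space n)"
    by (simp add: noise_measure_density)
  have T_eq: "?T m = (\<lambda>z. \<lambda>i\<in>{..<n}. signal L h c n m i + complex_of_real 1 * z i)" for m
    by (auto simp: channel_output_def signal_def fun_eq_iff)
  have T[measurable]: "?T m \<in> measurable (vec_space n) (vec_space n)" for m
    unfolding T_eq by (subst (2) vec_space_def, intro measurable_restrict) simp
  have dm: "(\<lambda>y. of_bool (d n j y \<noteq> k) :: real) \<in> borel_measurable (vec_space n)" for k
    by (rule measurable_compose[OF d]) simp
  have dT: "Measurable.pred (vec_space n) (\<lambda>z. d n j (?T m z) \<noteq> m j)" for m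
    by (rule measurable_compose[OF measurable_compose[OF T d]]) simp
  \<comment> \<open>The tuples form a countable type, so measurability in the noise for each fixed
    tuple is enough.\<close>
  have pm: "Measurable.pred ?M (\<lambda>w. d n j (?T (fst w) (snd w)) \<noteq> fst w j)"
  proof -
    have "(\<lambda>w. d n j (?T (fst w) (snd w)) \<noteq> fst w j) \<in> measurable (count_space UNIV \<Otimes>\<^sub>M noise_measure n) (count_space UNIV)"
      using dT by (intro measurable_pair_measure_countable1) (auto simp: measurable_cong_sets[OF sN refl])
    moreover have "sets ?M = sets (count_space UNIV \<Otimes>\<^sub>M noise_measure n)"
      unfolding M by (intro sets_pair_measure_cong) auto
    ultimately show ?thesis by (simp add: measurable_cong_sets)
  qed
  let ?S = "{w \<in> space ?M. d n j (?T (fst w) (snd w)) \<noteq> fst w j}"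
  have S: "?S \<in> sets ?M" using pm by measurable
  have "error_prob n R L h c j d = (\<integral>w. of_bool (d n j (?T (fst w) (snd w)) \<noteq> fst w j) \<partial>?M)"
  proof -
    have "error_prob n R L h c j d = (\<integral>w. indicator ?S w \<partial>?M)"
      unfolding error_prob_def using S by simp
    also have "\<dots> = (\<integral>w. of_bool (d n j (?T (fst w) (snd w)) \<noteq> fst w j) \<partial>?M)"
      by (rule Bochner_Integration.integral_cong) (auto simp: indicator_def)
    finally show ?thesis .
  qed
  also have "\<dots> = (\<integral>m. \<integral>z. of_bool (d n j (?T m z) \<noteq> m j) \<partial>noise_measure n \<partial>measure_pmf ?P)"
  proof -
    have "integrable ?M (\<lambda>w. of_bool (d n j (?T (fst w) (snd w)) \<noteq> fst w j) :: real)"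
      unfolding M using pm by (intro PN.integrable_const_bound[where B = 1]) (auto simp: M)
    then show ?thesis
      using PN.integral_fst'[of "\<lambda>w. of_bool (d n j (?T (fst w) (snd w)) \<noteq> fst w j) :: real"] unfolding M by simp
  qed
  also have "\<dots> = (\<Sum>m\<in>messages n R L. \<integral>z. of_bool (d n j (?T m z) \<noteq> m j) \<partial>noise_measure n) / real (card (messages n R L))"
    by (subst integral_pmf_of_set) auto
  also have "(\<Sum>m\<in>messages n R L. \<integral>z. of_bool (d n j (?T m z) \<noteq> m j) \<partial>noise_measure n)
     = (\<Sum>m\<in>messages n R L. \<integral>y. vgauss n 1 (signal L h c n m) y * of_bool (d n j y \<noteq> m j) \<partial>vec_space n)"
  proof (rule sum.cong)
    fix m
    let ?s = "signal L h c n m"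
    let ?F = "\<lambda>y. vgauss n 1 ?s y * of_bool (d n j y \<noteq> m j)"
    have v: "vgauss n 1 ?s (?T m z) = vgauss n 1 (\<lambda>_. 0) z" for z
      using sq_dist_affine[of n ?s 1 z "\<lambda>_. 0"] unfolding T_eq by (simp add: vgauss_def)
    have F: "?F \<in> borel_measurable (vec_space n)"
      using dm by (intro borel_measurable_times) auto
    have "(\<integral>y. ?F y \<partial>vec_space n) = (\<integral>y. ?F y \<partial>distr (vec_space n) (vec_space n) (?T m))"
      using vec_space_affine[of 1 n ?s] unfolding T_eq by (simp add: density_1)
    also have "\<dots> = (\<integral>z. ?F (?T m z) \<partial>vec_space n)"
      using F by (intro integral_distr) auto
    also have "\<dots> = (\<integral>z. of_bool (d n j (?T m z) \<noteq> m j) \<partial>noise_measure n)"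
    proof -
      have "(\<lambda>z. of_bool (d n j (?T m z) \<noteq> m j) :: real) \<in> borel_measurable (vec_space n)"
        by (rule measurable_compose[OF T dm])
      then show ?thesis
        unfolding noise_measure_density v
        by (subst integral_density) (auto intro!: AE_I2 less_imp_le vgauss_pos)
    qed
    finally show "(\<integral>z. of_bool (d n j (?T m z) \<noteq> m j) \<partial>noise_measure n) = (\<integral>y. ?F y \<partial>vec_space n)" ..
  qed simp
  finally show ?thesis .
qed

text \<open>The separate decoders of \<open>U\<close> form one decoder of the tuple, whose error the
  union bound controls by the sum of theirs. The interference from \<open>V\<close> is averaged out
  in the inner mixture.\<close>

lemma fano_messages:
  assumes UV: "U \<inter> V = {}" and d: "measurable_decoders U d"
  shows "ln (card (messages n R U)) + output_entropy n R V h c - output_entropy n R (U \<union> V :: 'k::finite set) h c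
    \<le> ln 2 + ln (card (messages n R U)) * (\<Sum>j\<in>U. error_prob n R (U \<union> V) h c j d)"
proof -
  let ?A = "messages n R U" and ?B = "messages n R V"
  let ?s = "\<lambda>w b i. signal U h c n w i + signal V h c n b i"
  \<comment> \<open>The value 0 outside \<open>U\<close> agrees with \<open>messages\<close>, so for
    \<open>w\<close> in \<open>messages n R U\<close> the joint estimate is wrong only if some
    decoder in \<open>U\<close> errs.\<close>
  define D where "D = (\<lambda>y l. if l \<in> U then d n l y else 0)"
  have dm: "d n j \<in> measurable (vec_space n) (count_space UNIV)" if "j \<in> U" for j
  proof -
    have "sets (\<Pi>\<^sub>M i\<in>{..<n}. borel :: complex measure) = sets (vec_space n)"
      unfolding vec_space_def by (intro sets_PiM_cong) auto
    then show ?thesis using d that unfolding measurable_decoders_def by (metis measurable_cong_sets)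
  qed
  have D_m: "D \<in> measurable (vec_space n) (count_space UNIV)"
  proof -
    have "D -` {w} \<inter> space (vec_space n) \<in> sets (vec_space n)" for w
    proof -
      have "Measurable.pred (vec_space n) (\<lambda>y. d n l y = w l)" if "l \<in> U" for l
        by (rule measurable_compose[OF dm[OF that]]) simp
      then have "Measurable.pred (vec_space n) (\<lambda>y. \<forall>l\<in>U. d n l y = w l)"
        by (intro pred_intros_finite) auto
      then have "{y \<in> space (vec_space n). \<forall>l\<in>U. d n l y = w l} \<in> sets (vec_space n)"
        by (simp add: pred_def)
      moreover have "D -` {w} \<inter> space (vec_space n)
        = (if \<forall>l. l \<notin> U \<longrightarrow> w l = 0 then {y \<in> space (vec_space n). \<forall>l\<in>U. d n l y = w l} else {})"
        by (auto simp: D_def fun_eq_iff)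
      ultimately show ?thesis by simp
    qed
    then show ?thesis by (intro measurable_count_space_eq_countable[THEN iffD2]) auto
  qed
  have bool_qb: "quad_bounded n (\<lambda>y. of_bool (d n j y \<noteq> k))" if "j \<in> U" for j k
  proof (rule quad_boundedI[where a = 1 and b = 0])
    show "(\<lambda>y. of_bool (d n j y \<noteq> k)) \<in> borel_measurable (vec_space n)"
      by (rule measurable_compose[OF dm[OF that]]) simp
  qed auto
  have D_qb: "quad_bounded n (\<lambda>y. of_bool (D y \<noteq> w))" for w
  proof (rule quad_boundedI[where a = 1 and b = 0])
    show "(\<lambda>y. of_bool (D y \<noteq> w)) \<in> borel_measurable (vec_space n)"
      by (rule measurable_compose[OF D_m]) simp
  qed auto
  have one: "(1::real) > 0" by simp
  have err: "(\<Sum>w\<in>?A. \<integral>y. mixture n 1 ?B (?s w) y * of_bool (D y \<noteq> w) \<partial>vec_space n) / real (card ?A)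
    \<le> (\<Sum>j\<in>U. error_prob n R (U \<union> V) h c j d)"
  proof -
    have "(\<integral>y. mixture n 1 ?B (?s w) y * of_bool (D y \<noteq> w) \<partial>vec_space n)
       \<le> (\<Sum>j\<in>U. \<integral>y. mixture n 1 ?B (?s w) y * of_bool (d n j y \<noteq> w j) \<partial>vec_space n)" if w: "w \<in> ?A" for w
    proof -
      have le: "of_bool (D y \<noteq> w) \<le> (\<Sum>j\<in>U. of_bool (d n j y \<noteq> w j) :: real)" for y
      proof (cases "D y = w")
        case False
        then obtain j where j: "D y j \<noteq> w j" by (auto simp: fun_eq_iff)
        with w have "j \<in> U" by (auto simp: D_def messages_def PiE_dflt_def split: if_splits)
        with j have "(1::real) \<le> of_bool (d n j y \<noteq> w j)" by (simp add: D_def)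
        also have "\<dots> \<le> (\<Sum>j\<in>U. of_bool (d n j y \<noteq> w j))"
          using \<open>j \<in> U\<close> by (intro member_le_sum) auto
        finally show ?thesis using False by simp
      qed (simp add: sum_nonneg)
      have "(\<integral>y. mixture n 1 ?B (?s w) y * of_bool (D y \<noteq> w) \<partial>vec_space n)
         \<le> (\<integral>y. (\<Sum>j\<in>U. mixture n 1 ?B (?s w) y * of_bool (d n j y \<noteq> w j)) \<partial>vec_space n)"
      proof (intro integral_mono)
        fix y
        show "mixture n 1 ?B (?s w) y * of_bool (D y \<noteq> w) \<le> (\<Sum>j\<in>U. mixture n 1 ?B (?s w) y * of_bool (d n j y \<noteq> w j))"
          unfolding sum_distrib_left[symmetric]
          by (intro mult_left_mono le less_imp_le mixture_pos) auto
      qed (rule Bochner_Integration.integrable_sum integral_mixture_mult(1)[OF one] bool_qb D_qb | assumption)+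
      also have "\<dots> = (\<Sum>j\<in>U. \<integral>y. mixture n 1 ?B (?s w) y * of_bool (d n j y \<noteq> w j) \<partial>vec_space n)"
        by (intro Bochner_Integration.integral_sum integral_mixture_mult(1)[OF one] bool_qb)
      finally show ?thesis .
    qed
    then have "(\<Sum>w\<in>?A. \<integral>y. mixture n 1 ?B (?s w) y * of_bool (D y \<noteq> w) \<partial>vec_space n) / real (card ?A)
       \<le> (\<Sum>w\<in>?A. \<Sum>j\<in>U. \<integral>y. mixture n 1 ?B (?s w) y * of_bool (d n j y \<noteq> w j) \<partial>vec_space n) / real (card ?A)"
      by (intro divide_right_mono sum_mono) auto
    also have "\<dots> = (\<Sum>j\<in>U. (\<Sum>w\<in>?A. \<integral>y. mixture n 1 ?B (?s w) y * of_bool (d n j y \<noteq> w j) \<partial>vec_space n) / real (card ?A))"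
      by (subst sum.swap) (simp add: sum_divide_distrib)
    also have "\<dots> = (\<Sum>j\<in>U. error_prob n R (U \<union> V) h c j d)"
    proof (rule sum.cong)
      fix j assume j: "j \<in> U"
      have "error_prob n R (U \<union> V) h c j d
        = (\<Sum>(w, b)\<in>?A \<times> ?B. \<integral>y. vgauss n 1 (?s w b) y * of_bool (d n j y \<noteq> w j) \<partial>vec_space n)
          / (real (card ?A) * real (card ?B))"
        unfolding error_prob_eq[where d = d and n = n and j = j, OF dm[OF j]]
        unfolding sum_messages_union[OF UV] card_messages_union[OF UV] card_cartesian_product
        using j by (simp add: signal_union[OF UV, THEN ext])
      also have "\<dots> = (\<Sum>w\<in>?A. \<integral>y. mixture n 1 ?B (?s w) y * of_bool (d n j y \<noteq> w j) \<partial>vec_space n) / real (card ?A)"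
        unfolding integral_mixture_mult(2)[OF one bool_qb[OF j]]
        by (simp add: sum.cartesian_product[symmetric] sum_divide_distrib[symmetric] mult.commute)
      finally show "(\<Sum>w\<in>?A. \<integral>y. mixture n 1 ?B (?s w) y * of_bool (d n j y \<noteq> w j) \<partial>vec_space n) / real (card ?A)
         = error_prob n R (U \<union> V) h c j d" ..
    qed simp
    finally show ?thesis .
  qed
  have lnA: "0 \<le> ln (real (card ?A))" using card_messages_pos[of n R U] by simp
  have "ln (card ?A) + output_entropy n R V h c - output_entropy n R (U \<union> V) h c
    \<le> ln 2 + ln (card ?A) * ((\<Sum>w\<in>?A. \<integral>y. mixture n 1 ?B (?s w) y * of_bool (D y \<noteq> w) \<partial>vec_space n) / real (card ?A))"
    using fano_mixture[where v = 1 and A = ?A and B = ?B and D = D and s = ?s and n = n] D_m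
    unfolding output_entropy_def mixture_messages[OF UV]
    by (simp add: diff_entropy_translate)
  also have "\<dots> \<le> ln 2 + ln (card ?A) * (\<Sum>j\<in>U. error_prob n R (U \<union> V) h c j d)"
    using err lnA by (intro add_left_mono mult_left_mono)
  finally show ?thesis .
qed

section \<open>Received power and its effect on the output entropy\<close>

lemma sum_norm_centered_le:
  fixes f :: "'a \<Rightarrow> 'b::real_inner"
  assumes "finite A"
  shows "(\<Sum>x\<in>A. (norm (f x - (\<Sum>x\<in>A. f x) /\<^sub>R real (card A)))\<^sup>2) \<le> (\<Sum>x\<in>A. (norm (f x))\<^sup>2)"
proof -
  define \<mu> where "\<mu> = (\<Sum>x\<in>A. f x) /\<^sub>R real (card A)"
  have s: "(\<Sum>x\<in>A. f x) = real (card A) *\<^sub>R \<mu>" using assms by (cases "A = {}") (auto simp: \<mu>_def)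
  have "(\<Sum>x\<in>A. (norm (f x - \<mu>))\<^sup>2) = (\<Sum>x\<in>A. (norm (f x))\<^sup>2) - 2 * ((\<Sum>x\<in>A. f x) \<bullet> \<mu>) + real (card A) * (\<mu> \<bullet> \<mu>)"
  proof -
    have "(norm (f x - \<mu>))\<^sup>2 = (norm (f x))\<^sup>2 - 2 * (f x \<bullet> \<mu>) + \<mu> \<bullet> \<mu>" for x
      by (simp add: power2_norm_eq_inner inner_diff_left inner_diff_right inner_commute)
    then show ?thesis
      by (simp add: sum_subtractf sum.distrib inner_sum_left sum_distrib_left)
  qed
  also have "\<dots> = (\<Sum>x\<in>A. (norm (f x))\<^sup>2) - real (card A) * (\<mu> \<bullet> \<mu>)" unfolding s by simp
  also have "\<dots> \<le> (\<Sum>x\<in>A. (norm (f x))\<^sup>2)" by simp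
  finally show ?thesis by (simp add: \<mu>_def)
qed

text \<open>Powers of independent signals add once one of them has mean zero, because the cross
  terms factor through that mean.\<close>

lemma sum_norm_add_centered:
  fixes f :: "'a \<Rightarrow> 'b::real_inner" and g :: "'c \<Rightarrow> 'b"
  assumes "(\<Sum>x\<in>A. f x) = 0"
  shows "(\<Sum>(x, y)\<in>A \<times> B. (norm (f x + g y))\<^sup>2)
    = real (card B) * (\<Sum>x\<in>A. (norm (f x))\<^sup>2) + real (card A) * (\<Sum>y\<in>B. (norm (g y))\<^sup>2)"
proof -
  have "(\<Sum>x\<in>A. \<Sum>y\<in>B. f x \<bullet> g y) = (\<Sum>x\<in>A. f x) \<bullet> (\<Sum>y\<in>B. g y)"
    by (simp add: inner_sum_left inner_sum_right) (rule sum.swap)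
  then have z: "(\<Sum>x\<in>A. \<Sum>y\<in>B. f x \<bullet> g y) = 0" using assms by simp
  have "(\<Sum>(x, y)\<in>A \<times> B. (norm (f x + g y))\<^sup>2)
    = (\<Sum>x\<in>A. \<Sum>y\<in>B. (norm (f x))\<^sup>2 + (norm (g y))\<^sup>2 + 2 * (f x \<bullet> g y))"
    by (simp add: sum.cartesian_product[symmetric] power2_norm_eq_inner inner_add_left inner_add_right
      inner_commute algebra_simps)
  also have "\<dots> = real (card B) * (\<Sum>x\<in>A. (norm (f x))\<^sup>2) + real (card A) * (\<Sum>y\<in>B. (norm (g y))\<^sup>2)"
    using z by (simp add: sum.distrib sum_distrib_left[symmetric])
  finally show ?thesis .
qed

text \<open>Codebooks need not have mean zero, and then the powers of superposed signals would not
  add. Centring the signal of each transmitter at its mean removes the cross terms and does not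
  increase the power; \<open>u\<close> is built as the sum of these means.\<close>

lemma signal_power_le:
  assumes "power_constraint Q (R :: real ^ 'k) UNIV c" "n \<ge> 1"
  shows "\<exists>u. (\<Sum>m\<in>messages n R W. sq_dist n (signal (W :: 'k::finite set) h c n m) u) / real (card (messages n R W))
    \<le> real n * (\<Sum>l\<in>W. (cmod (h l))\<^sup>2 * Q)"
  using finite[of W]
proof (induction W rule: finite_induct)
  case empty
  have "messages n R {} = {\<lambda>_. 0}" by (auto simp: messages_def PiE_dflt_def)
  then show ?case by (intro exI[of _ "\<lambda>_. 0"]) (simp add: sq_dist_def signal_def)
next
  case (insert l V)
  let ?A = "messages n R {l}" and ?B = "messages n R V"
  let ?a = "signal {l} h c n" and ?b = "signal V h c n"
  obtain u where u: "(\<Sum>m\<in>?B. sq_dist n (?b m) u) / real (card ?B) \<le> real n * (\<Sum>l\<in>V. (cmod (h l))\<^sup>2 * Q)"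
    using insert.IH by auto
  define \<mu> where "\<mu> = (\<lambda>i. (\<Sum>w\<in>?A. ?a w i) /\<^sub>R real (card ?A))"
  have dis: "{l} \<inter> V = {}" "{l} \<union> V = insert l V" using insert by auto
  have cA: "real (card ?A) > 0" and cB: "real (card ?B) > 0" using card_messages_pos by auto
  have centered: "(\<Sum>w\<in>?A. ?a w i - \<mu> i) = 0" for i
    using cA by (simp add: sum_subtractf \<mu>_def scaleR_conv_of_real)
  have A: "(\<Sum>w\<in>?A. sq_dist n (?a w) \<mu>) \<le> real (card ?A) * (real n * ((cmod (h l))\<^sup>2 * Q))"
  proof -
    have "(\<Sum>w\<in>?A. sq_dist n (?a w) \<mu>) = (\<Sum>i<n. \<Sum>w\<in>?A. (cmod (?a w i - \<mu> i))\<^sup>2)"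
      unfolding sq_dist_def by (rule sum.swap)
    also have "\<dots> \<le> (\<Sum>i<n. \<Sum>w\<in>?A. (cmod (?a w i))\<^sup>2)"
      unfolding \<mu>_def by (intro sum_mono sum_norm_centered_le) simp
    also have "\<dots> = (\<Sum>w\<in>?A. (cmod (h l))\<^sup>2 * (\<Sum>i<n. (cmod (c n l (w l) i))\<^sup>2))"
      by (subst sum.swap, intro sum.cong refl) (simp add: signal_def norm_mult power_mult_distrib sum_distrib_left)
    also have "\<dots> \<le> (\<Sum>w\<in>?A. (cmod (h l))\<^sup>2 * (real n * Q))"
    proof (intro sum_mono mult_left_mono)
      fix w assume "w \<in> ?A"
      then have "w l \<in> message_set n (R $ l)" by (auto simp: messages_def PiE_dflt_def)
      then have "(1 / real n) * (\<Sum>i<n. (cmod (c n l (w l) i))\<^sup>2) \<le> Q"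
        using assms unfolding power_constraint_def by blast
      then show "(\<Sum>i<n. (cmod (c n l (w l) i))\<^sup>2) \<le> real n * Q"
        using assms(2) by (simp add: field_simps)
    qed simp
    finally show ?thesis by (simp add: mult_ac)
  qed
  have "(\<Sum>m\<in>messages n R ({l} \<union> V). sq_dist n (signal ({l} \<union> V) h c n m) (\<lambda>i. \<mu> i + u i))
     = (\<Sum>(w, b)\<in>?A \<times> ?B. \<Sum>i<n. (cmod ((?a w i - \<mu> i) + (?b b i - u i)))\<^sup>2)"
    unfolding sum_messages_union[OF dis(1)] sq_dist_def signal_union[OF dis(1)] add_diff_add ..
  also have "\<dots> = (\<Sum>i<n. \<Sum>(w, b)\<in>?A \<times> ?B. (cmod ((?a w i - \<mu> i) + (?b b i - u i)))\<^sup>2)"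
    unfolding split_beta by (rule sum.swap)
  also have "\<dots> = (\<Sum>i<n. real (card ?B) * (\<Sum>w\<in>?A. (cmod (?a w i - \<mu> i))\<^sup>2)
      + real (card ?A) * (\<Sum>b\<in>?B. (cmod (?b b i - u i))\<^sup>2))"
    by (intro sum.cong refl sum_norm_add_centered centered)
  also have "\<dots> = real (card ?B) * (\<Sum>w\<in>?A. sq_dist n (?a w) \<mu>) + real (card ?A) * (\<Sum>b\<in>?B. sq_dist n (?b b) u)"
  proof -
    have "(\<Sum>i<n. \<Sum>w\<in>?A. (cmod (?a w i - \<mu> i))\<^sup>2) = (\<Sum>w\<in>?A. sq_dist n (?a w) \<mu>)"
      "(\<Sum>i<n. \<Sum>b\<in>?B. (cmod (?b b i - u i))\<^sup>2) = (\<Sum>b\<in>?B. sq_dist n (?b b) u)"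
      unfolding sq_dist_def by (rule sum.swap)+
    then show ?thesis unfolding sum.distrib sum_distrib_left[symmetric] by (simp only:)
  qed
  also have "\<dots> \<le> real (card ?B) * (real (card ?A) * (real n * ((cmod (h l))\<^sup>2 * Q)))
      + real (card ?A) * (real (card ?B) * (real n * (\<Sum>l\<in>V. (cmod (h l))\<^sup>2 * Q)))"
    using u unfolding pos_divide_le_eq[OF cB] mult.commute[of _ "real (card ?B)"]
    by (intro add_mono mult_left_mono A) auto
  also have "\<dots> = (real (card ?A) * real (card ?B)) * (real n * (\<Sum>l\<in>insert l V. (cmod (h l))\<^sup>2 * Q))"
    using insert.hyps by (simp add: distrib_left mult_ac)
  finally have "(\<Sum>m\<in>messages n R (insert l V). sq_dist n (signal (insert l V) h c n m) (\<lambda>i. \<mu> i + u i))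
    \<le> real (card (messages n R (insert l V))) * (real n * (\<Sum>l\<in>insert l V. (cmod (h l))\<^sup>2 * Q))"
    unfolding dis(2)[symmetric] card_messages_union[OF dis(1)] card_cartesian_product of_nat_mult .
  then have "(\<Sum>m\<in>messages n R (insert l V). sq_dist n (signal (insert l V) h c n m) (\<lambda>i. \<mu> i + u i))
      / real (card (messages n R (insert l V))) \<le> real n * (\<Sum>l\<in>insert l V. (cmod (h l))\<^sup>2 * Q)"
    using card_messages_pos[of n R "insert l V"] by (subst pos_divide_le_eq) (auto simp only: of_nat_0_less_iff mult.commute)
  then show ?case by (rule exI[where x = "\<lambda>i. \<mu> i + u i"])
qed

lemma output_entropy_le_gaussian:
  assumes "power_constraint Q R UNIV c" "n \<ge> 1" "Q \<ge> 0"
  shows "output_entropy n R (W :: 'k::finite set) h c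
    \<le> real n * ln pi + real n + real n * ln (1 + (\<Sum>l\<in>W. (cmod (h l))\<^sup>2 * Q))"
proof -
  let ?P = "\<Sum>l\<in>W. (cmod (h l))\<^sup>2 * Q"
  obtain u where u: "(\<Sum>m\<in>messages n R W. sq_dist n (signal W h c n m) u) / real (card (messages n R W)) \<le> real n * ?P"
    using signal_power_le[OF assms(1,2)] by blast
  have P: "1 + ?P > 0" using assms(3) by (intro add_pos_nonneg sum_nonneg) auto
  have "output_entropy n R W h c \<le> real n * ln (pi * (1 + ?P))
      + (real n * 1 + (\<Sum>m\<in>messages n R W. sq_dist n (signal W h c n m) u) / real (card (messages n R W))) / (1 + ?P)"
    unfolding output_entropy_def using P by (intro diff_entropy_mixture_le) auto
  also have "\<dots> \<le> real n * ln (pi * (1 + ?P)) + (real n * (1 + ?P)) / (1 + ?P)"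
    using u P by (intro add_left_mono divide_right_mono) (auto simp: distrib_left)
  also have "\<dots> = real n * ln pi + real n + real n * ln (1 + ?P)"
    using P by (simp add: ln_mult_pos distrib_left[symmetric])
  finally show ?thesis .
qed

lemma output_entropy_scale_le:
  assumes "power_constraint Q R UNIV c" "n \<ge> 1" "Q \<ge> 0" "b \<ge> 1"
  shows "output_entropy n R (W :: 'k::finite set) (\<lambda>l. complex_of_real (sqrt b) * h l) c - output_entropy n R W h c
    \<le> real n * ln ((1 + b * (\<Sum>l\<in>W. (cmod (h l))\<^sup>2 * Q)) / (1 + (\<Sum>l\<in>W. (cmod (h l))\<^sup>2 * Q)))"
\<comment> \<open>\<open>diff_entropy_gain_le\<close> adds noise of variance \<open>b - 1\<close>,
  which has to be positive.\<close>
proof (cases "b = 1")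
  case True
  have "1 + (\<Sum>l\<in>W. (cmod (h l))\<^sup>2 * Q) > 0" using assms(3) by (intro add_pos_nonneg sum_nonneg) auto
  with True show ?thesis by simp
next
  case False
  obtain u where u: "(\<Sum>m\<in>messages n R W. sq_dist n (signal W h c n m) u) / real (card (messages n R W))
      \<le> real n * (\<Sum>l\<in>W. (cmod (h l))\<^sup>2 * Q)"
    using signal_power_le[OF assms(1,2)] by blast
  have "signal W (\<lambda>l. complex_of_real (sqrt b) * h l) c n = (\<lambda>m i. complex_of_real (sqrt b) * signal W h c n m i)"
    by (auto simp: signal_def fun_eq_iff sum_distrib_left mult_ac)
  then show ?thesis
    unfolding output_entropy_def
    using diff_entropy_gain_le[OF _ finite_messages messages_nonempty u, of b] False assms
    by (simp add: sum_nonneg)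
qed

section \<open>Undecodable sets of transmitters\<close>

text \<open>The rate conditions under which a MAC-capacity-achieving code guarantees decoding of
  \<open>U\<close> with \<open>\<Omega> - U\<close> as noise; \<open>p\<close> gives the received
  powers. Only rates and powers occur, which keeps the combinatorics below free of codes.\<close>

definition decodable :: "('k \<Rightarrow> real) \<Rightarrow> ('k \<Rightarrow> real) \<Rightarrow> 'k set \<Rightarrow> 'k set \<Rightarrow> bool" where
  "decodable r p \<Omega> U \<longleftrightarrow> U \<noteq> {} \<and> U \<subseteq> \<Omega> \<and>
    (\<forall>T. T \<noteq> {} \<longrightarrow> T \<subseteq> U \<longrightarrow> sum r T < gauss_C (sum p T / (1 + sum p (\<Omega> - U))))"

text \<open>Successive decoding: \<open>B\<close> over noise and \<open>A\<close>, then
  \<open>A\<close> over noise alone, together reach the joint rate, since the logarithms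
  telescope.\<close>

lemma gauss_C_chain:
  assumes "A \<ge> 0" "B \<ge> 0" "N \<ge> 0"
  shows "gauss_C (A / (1 + N)) + gauss_C (B / (1 + (N + A))) = gauss_C ((A + B) / (1 + N))"
proof -
  have "1 + A / (1 + N) = (1 + N + A) / (1 + N)" "1 + B / (1 + (N + A)) = (1 + N + A + B) / (1 + N + A)"
    "1 + (A + B) / (1 + N) = (1 + N + A + B) / (1 + N)"
    using assms by (auto simp: field_simps)
  then show ?thesis
    using assms unfolding gauss_C_def by (simp add: log_divide)
qed

lemma gauss_C_mono: "0 \<le> x \<Longrightarrow> x \<le> y \<Longrightarrow> gauss_C x \<le> gauss_C y"
  by (simp add: gauss_C_def)

lemma gauss_C_0 [simp]: "gauss_C 0 = 0"
  by (simp add: gauss_C_def)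

lemma tendsto_gauss_C:
  assumes "A \<ge> 0" "B \<ge> 0" "x \<ge> 0"
  shows "((\<lambda>x. gauss_C (x * A / (1 + x * B))) \<longlongrightarrow> gauss_C (x * A / (1 + x * B))) (at x within S)"
proof -
  have "1 + x * B > 0" using assms by (simp add: add_pos_nonneg)
  moreover have "x * A / (1 + x * B) \<ge> 0" using assms by simp
  ultimately show ?thesis
    unfolding gauss_C_def by (intro tendsto_intros) auto
qed

text \<open>Decode \<open>U\<close> first with everything else as noise, subtract it, then decode
  \<open>V\<close>.\<close>

lemma decodable_union:
  fixes \<Omega> :: "'k::finite set"
  assumes p: "\<And>l. l \<in> \<Omega> \<Longrightarrow> 0 \<le> p l" and U: "decodable r p \<Omega> U" and V: "decodable r p (\<Omega> - U) V"
  shows "decodable r p \<Omega> (U \<union> V)"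
  unfolding decodable_def
proof (intro conjI allI impI)
  show "U \<union> V \<noteq> {}" "U \<union> V \<subseteq> \<Omega>" using U V by (auto simp: decodable_def)
  fix T assume T: "T \<noteq> {}" "T \<subseteq> U \<union> V"
  have sub: "U \<subseteq> \<Omega>" "V \<subseteq> \<Omega> - U" using U V by (auto simp: decodable_def)
  define N where "N = sum p (\<Omega> - U - V)"
  have nn: "0 \<le> sum p X" if "X \<subseteq> \<Omega>" for X using p that by (intro sum_nonneg) auto
  have split: "sum f T = sum f (T \<inter> U) + sum f (T \<inter> V)" for f :: "'k \<Rightarrow> real"
  proof -
    have "T = (T \<inter> U) \<union> (T \<inter> V)" "(T \<inter> U) \<inter> (T \<inter> V) = {}" using T sub by auto
    then show ?thesis using sum.union_disjoint[of "T \<inter> U" "T \<inter> V" f] by simp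
  qed
  have NV: "sum p (\<Omega> - U) = N + sum p V"
    unfolding N_def using sub by (simp add: sum.subset_diff[of V "\<Omega> - U" p])
  have TV: "sum p (T \<inter> V) \<le> sum p V" using p sub by (intro sum_mono2) auto
  have N: "N \<ge> 0" "sum p (T \<inter> U) \<ge> 0" "sum p (T \<inter> V) \<ge> 0"
    using nn[of "T \<inter> U"] nn[of "T \<inter> V"] sub unfolding N_def by (auto intro: nn)
  \<comment> \<open>Lowering the interference from \<open>V\<close> to \<open>T \<inter> V\<close>
    only relaxes the constraint on \<open>T \<inter> U\<close>, and it makes the two bounds fit the
    chain rule.\<close>
  have mono: "gauss_C (sum p (T \<inter> U) / (1 + sum p (\<Omega> - U))) \<le> gauss_C (sum p (T \<inter> U) / (1 + (N + sum p (T \<inter> V))))"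
    using N TV unfolding NV by (intro gauss_C_mono divide_left_mono divide_nonneg_pos mult_pos_pos) auto
  have U1: "T \<inter> U \<noteq> {} \<Longrightarrow> sum r (T \<inter> U) < gauss_C (sum p (T \<inter> U) / (1 + (N + sum p (T \<inter> V))))"
    using U mono unfolding decodable_def by (meson inf_le2 less_le_trans)
  have V1: "T \<inter> V \<noteq> {} \<Longrightarrow> sum r (T \<inter> V) < gauss_C (sum p (T \<inter> V) / (1 + N))"
    using V unfolding decodable_def N_def by (meson inf_le2)
  have dd: "\<Omega> - (U \<union> V) = \<Omega> - U - V" by auto
  have "T \<inter> U \<noteq> {} \<or> T \<inter> V \<noteq> {}" using T by auto
  then have "sum r (T \<inter> U) + sum r (T \<inter> V)
     < gauss_C (sum p (T \<inter> V) / (1 + N)) + gauss_C (sum p (T \<inter> U) / (1 + (N + sum p (T \<inter> V))))"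
    using U1 V1 by (cases "T \<inter> U = {}"; cases "T \<inter> V = {}") auto
  also have "\<dots> = gauss_C (sum p T / (1 + N))"
    using gauss_C_chain[OF N(3) N(2) N(1)] split[of p] by (simp add: add.commute)
  finally show "sum r T < gauss_C (sum p T / (1 + sum p (\<Omega> - (U \<union> V))))"
    unfolding split[of r] dd N_def .
qed

text \<open>Tight sets grow: if a maximal tight \<open>T\<close> misses part of \<open>U\<close>,
  then \<open>U - T\<close> is not decodable, so some \<open>T2\<close> inside it meets or exceeds
  its bound with \<open>T\<close> counted as noise. By the chain rule \<open>T \<union> T2\<close>
  meets or exceeds its own bound, and the weak constraints make it tight.\<close>

lemma tight_decodable:
  fixes \<Omega> :: "'k::finite set"
  assumes p: "\<And>l. l \<in> \<Omega> \<Longrightarrow> 0 \<le> p l" and U: "U \<subseteq> \<Omega>"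
    and weak: "\<And>T. T \<subseteq> U \<Longrightarrow> sum r T \<le> gauss_C (sum p T / (1 + sum p (\<Omega> - U)))"
    and none: "\<And>W. \<not> decodable r p \<Omega> W"
  shows "sum r U = gauss_C (sum p U / (1 + sum p (\<Omega> - U)))"
proof -
  define N where "N = sum p (\<Omega> - U)"
  define tight where "tight T \<longleftrightarrow> T \<subseteq> U \<and> sum r T = gauss_C (sum p T / (1 + N))" for T
  have "tight {}" by (simp add: tight_def)
  then obtain T where T: "tight T" and max: "\<And>T'. tight T' \<Longrightarrow> T \<subseteq> T' \<Longrightarrow> T' = T"
    using finite_has_maximal[of "Collect tight"] by auto
  have nn: "0 \<le> sum p X" if "X \<subseteq> \<Omega>" for X using p that by (intro sum_nonneg) auto
  have "T = U"
  proof (rule ccontr)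
    assume "T \<noteq> U"
    then have W: "U - T \<noteq> {}" "U - T \<subseteq> \<Omega>" using T U by (auto simp: tight_def)
    then obtain T2 where T2: "T2 \<noteq> {}" "T2 \<subseteq> U - T"
      "gauss_C (sum p T2 / (1 + sum p (\<Omega> - (U - T)))) \<le> sum r T2"
      using none[of "U - T"] unfolding decodable_def by (meson not_le)
    have TU: "T \<subseteq> U" using T by (simp add: tight_def)
    have "\<Omega> - (U - T) = (\<Omega> - U) \<union> T" "(\<Omega> - U) \<inter> T = {}" using TU U by auto
    then have "sum p (\<Omega> - (U - T)) = N + sum p T" by (simp add: N_def sum.union_disjoint)
    then have "sum r T + sum r T2 \<ge> gauss_C (sum p T / (1 + N)) + gauss_C (sum p T2 / (1 + (N + sum p T)))"
      using T T2(3) by (simp add: tight_def)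
    also have "gauss_C (sum p T / (1 + N)) + gauss_C (sum p T2 / (1 + (N + sum p T)))
      = gauss_C ((sum p T + sum p T2) / (1 + N))"
      using TU T2 U by (intro gauss_C_chain) (auto simp: N_def intro!: nn)
    finally have ge: "gauss_C ((sum p T + sum p T2) / (1 + N)) \<le> sum r T + sum r T2" .
    have un: "sum f (T \<union> T2) = sum f T + sum f T2" for f :: "'k \<Rightarrow> real"
      using T2 by (intro sum.union_disjoint) auto
    have "T \<union> T2 \<subseteq> U" using TU T2 by auto
    with weak[of "T \<union> T2"] ge have "tight (T \<union> T2)"
      by (simp add: tight_def un N_def)
    from max[OF this] T2 show False by auto
  qed
  with T show ?thesis by (simp add: tight_def N_def)
qed

text \<open>\<open>H n \<Omega> a\<close> stands for the entropy excess at received powers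
  \<open>a * P l\<close>. Codes enter only through \<open>zero\<close>, \<open>scale\<close> and
  \<open>decode\<close>. The powers are positive so that amplification eventually makes all of
  \<open>\<Omega>\<close> decodable.\<close>

lemma eventually_near_gaussian:
  fixes P r :: "'k::finite \<Rightarrow> real" and H :: "nat \<Rightarrow> 'k set \<Rightarrow> real \<Rightarrow> real"
  assumes P: "\<And>l. l \<in> L \<Longrightarrow> 0 < P l"
    and zero: "\<And>a. eventually (\<lambda>n. H n {} a = 0) sequentially"
    and scale: "\<And>\<Omega> a x. \<Omega> \<subseteq> L \<Longrightarrow> 0 < a \<Longrightarrow> a \<le> x \<Longrightarrow>
        eventually (\<lambda>n. H n \<Omega> x - H n \<Omega> a \<le> gauss_C (x * sum P \<Omega>) - gauss_C (a * sum P \<Omega>)) sequentially"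
    and decode: "\<And>\<Omega> a U \<delta>. \<Omega> \<subseteq> L \<Longrightarrow> 0 < a \<Longrightarrow> decodable r (\<lambda>l. a * P l) \<Omega> U \<Longrightarrow> 0 < \<delta> \<Longrightarrow>
        eventually (\<lambda>n. H n (\<Omega> - U) a + sum r U - \<delta> \<le> H n \<Omega> a) sequentially"
    and "\<Omega> \<subseteq> L" "0 < a" "\<And>U. \<not> decodable r (\<lambda>l. a * P l) \<Omega> U" "0 < \<delta>"
  shows "eventually (\<lambda>n. gauss_C (a * sum P \<Omega>) - \<delta> \<le> H n \<Omega> a) sequentially"
  using assms(5-8)
proof (induction "card \<Omega>" arbitrary: \<Omega> a \<delta> rule: less_induct)
  case less
  note none = less.prems(3)
  show ?case
  proof (cases "\<Omega> = {}")
    case True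
    with less.prems zero[of a] show ?thesis by (auto elim: eventually_mono)
  next
    case False
    let ?D = "\<lambda>x U. decodable r (\<lambda>l. x * P l) \<Omega> U"
    have Pos: "0 < P l" if "l \<in> \<Omega>" for l using P less.prems that by auto
    have Pnn: "0 \<le> sum P X" if "X \<subseteq> \<Omega>" for X using Pos that by (intro sum_nonneg) (auto intro: less_imp_le)
    have PX: "sum (\<lambda>l. x * P l) X = x * sum P X" for x X by (simp add: sum_distrib_left)
    define N where "N = {x. a \<le> x \<and> (\<forall>U. \<not> ?D x U)}"
    have aN: "a \<in> N" using none by (simp add: N_def)
    have bdd: "bdd_above N"
    proof -
      \<comment> \<open>Once \<open>x * m\<close> exceeds \<open>2 powr M\<close>, every nonempty
        subset of \<open>\<Omega>\<close> satisfies its interference-free constraint, so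
        \<open>\<Omega>\<close> itself is decodable.\<close>
      define m where "m = Min (P ` \<Omega>)"
      define M where "M = (\<Sum>l\<in>\<Omega>. \<bar>r l\<bar>)"
      have m: "m > 0" "\<And>l. l \<in> \<Omega> \<Longrightarrow> m \<le> P l" using Pos False by (auto simp: m_def)
      have "x \<le> 2 powr M / m" if "x \<in> N" for x
      proof (rule ccontr)
        assume "\<not> x \<le> 2 powr M / m"
        then have x: "2 powr M < x * m" using m by (simp add: field_simps)
        have xpos: "0 < x" using that less.prems by (simp add: N_def)
        have "?D x \<Omega>"
          unfolding decodable_def PX
        proof (intro conjI allI impI)
          fix T assume T: "T \<noteq> {}" "T \<subseteq> \<Omega>"
          then obtain l where l: "l \<in> T" by auto
          have "sum r T \<le> M" unfolding M_def
            using sum_mono2[of \<Omega> T "\<lambda>l. \<bar>r l\<bar>"] sum_mono[of T r "\<lambda>l. \<bar>r l\<bar>"] T by force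
          also have "M = log 2 (2 powr M)" by simp
          also have "\<dots> < log 2 (1 + x * sum P T)"
          proof -
            have "P l \<le> sum P T" using l T Pos by (intro member_le_sum) (auto intro: less_imp_le)
            then have "x * m \<le> x * sum P T" using m(2)[of l] l T xpos by (intro mult_left_mono) auto
            then have "2 powr M < 1 + x * sum P T" using x by linarith
            then show ?thesis using powr_gt_zero[of 2 M] by (subst log_less_cancel_iff) linarith+
          qed
          finally show "sum r T < gauss_C (x * sum P T / (1 + x * sum P (\<Omega> - \<Omega>)))"
            by (simp add: gauss_C_def)
        qed (use False in auto)
        with that show False by (auto simp: N_def)
      qed
      then show ?thesis by (auto simp: bdd_above_def)
    qed
    define \<alpha> where "\<alpha> = Sup N"
    have a\<alpha>: "a \<le> \<alpha>" unfolding \<alpha>_def using aN bdd by (rule cSup_upper)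
    then have \<alpha>0: "0 < \<alpha>" using less.prems by simp
    have tend: "((\<lambda>x. gauss_C (x * sum P X / (1 + x * sum P Y))) \<longlongrightarrow> gauss_C (\<alpha> * sum P X / (1 + \<alpha> * sum P Y))) (at \<alpha> within S)"
      if "X \<subseteq> \<Omega>" "Y \<subseteq> \<Omega>" for X Y S
      using that \<alpha>0 by (intro tendsto_gauss_C Pnn) auto
    have above: "\<exists>U. ?D x U" if "\<alpha> < x" for x
      using that a\<alpha> cSup_upper[OF _ bdd, of x] unfolding \<alpha>_def[symmetric] by (force simp: N_def)
    \<comment> \<open>Decodability is a finite set of strict inequalities between continuous
      functions, hence open in the factor. If it held at \<open>\<alpha>\<close>, it would also hold
      at a member of \<open>N\<close> close to or equal to \<open>\<alpha>\<close>.\<close>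
    have at_\<alpha>: "\<not> ?D \<alpha> U" for U
    proof
      assume D: "?D \<alpha> U"
      have "eventually (\<lambda>x. \<forall>T\<in>{T. T \<noteq> {} \<and> T \<subseteq> U}. sum r T < gauss_C (x * sum P T / (1 + x * sum P (\<Omega> - U)))) (at \<alpha>)"
      proof (rule eventually_ball_finite)
        show "\<forall>T\<in>{T. T \<noteq> {} \<and> T \<subseteq> U}.
            eventually (\<lambda>x. sum r T < gauss_C (x * sum P T / (1 + x * sum P (\<Omega> - U)))) (at \<alpha>)"
        proof
          fix T assume T: "T \<in> {T. T \<noteq> {} \<and> T \<subseteq> U}"
          then have "sum r T < gauss_C (\<alpha> * sum P T / (1 + \<alpha> * sum P (\<Omega> - U)))" "T \<subseteq> \<Omega>"
            using D unfolding decodable_def PX by auto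
          then show "eventually (\<lambda>x. sum r T < gauss_C (x * sum P T / (1 + x * sum P (\<Omega> - U)))) (at \<alpha>)"
            by (intro order_tendstoD(1)[OF tend[of T "\<Omega> - U"]]) auto
        qed
      qed simp
      then have "eventually (\<lambda>x. ?D x U) (at \<alpha>)"
      proof (rule eventually_mono)
        fix x assume "\<forall>T\<in>{T. T \<noteq> {} \<and> T \<subseteq> U}. sum r T < gauss_C (x * sum P T / (1 + x * sum P (\<Omega> - U)))"
        with D show "?D x U" unfolding decodable_def PX by blast
      qed
      then obtain e where e: "e > 0" "\<And>x. x \<noteq> \<alpha> \<Longrightarrow> dist x \<alpha> < e \<Longrightarrow> ?D x U"
        unfolding eventually_at by auto
      obtain x where x: "x \<in> N" "\<alpha> - e < x"
        using less_cSupD[of N "\<alpha> - e"] aN e(1) unfolding \<alpha>_def[symmetric] by auto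
      have "x \<le> \<alpha>" unfolding \<alpha>_def using x(1) bdd by (rule cSup_upper)
      with x e D have "?D x U" by (cases "x = \<alpha>") (auto simp: dist_real_def)
      with x show False by (auto simp: N_def)
    qed
    \<comment> \<open>\<open>U\<close> is a decodable set after which nothing more is decodable;
      this is what the induction hypothesis asks of \<open>\<Omega> - U\<close>.\<close>
    define Mx where "Mx x U \<longleftrightarrow> ?D x U \<and> (\<forall>V. \<not> decodable r (\<lambda>l. x * P l) (\<Omega> - U) V)" for x U
    have "\<exists>U. Mx x U" if x: "\<alpha> < x" for x
    proof -
      obtain U where U: "?D x U" and max: "\<And>U'. ?D x U' \<Longrightarrow> U \<subseteq> U' \<Longrightarrow> U' = U"
        using finite_has_maximal[of "Collect (?D x)"] above[OF x] by auto
      have "\<not> decodable r (\<lambda>l. x * P l) (\<Omega> - U) V" for V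
      proof
        assume V: "decodable r (\<lambda>l. x * P l) (\<Omega> - U) V"
        have "?D x (U \<union> V)" using x \<alpha>0 Pos by (intro decodable_union U V) (auto intro: less_imp_le)
        from max[OF this] V show False by (auto simp: decodable_def)
      qed
      with U show ?thesis by (auto simp: Mx_def)
    qed
    then have "eventually (\<lambda>x. \<exists>U\<in>UNIV. Mx x U) (at_right \<alpha>)"
      by (auto simp: eventually_at_right_less intro: eventually_mono[OF eventually_at_right_less])
    \<comment> \<open>There are finitely many sets, so one fixed \<open>U\<close> works for factors
      arbitrarily close to \<open>\<alpha>\<close> from above. Its strict constraints there become
      weak ones at \<open>\<alpha>\<close>.\<close>
    then have "frequently (\<lambda>x. \<exists>U\<in>UNIV. Mx x U) (at_right \<alpha>)"
      by (intro eventually_frequently) auto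
    then obtain U where U: "frequently (\<lambda>x. Mx x U) (at_right \<alpha>)"
      using frequently_bex_finite[of UNIV "\<lambda>x U. Mx x U"] by auto
    then have UO: "U \<subseteq> \<Omega>" "U \<noteq> {}" by (auto simp: Mx_def decodable_def dest!: frequently_ex)
    have tight: "sum r U = gauss_C (\<alpha> * sum P U / (1 + \<alpha> * sum P (\<Omega> - U)))"
    proof -
      have "sum r T \<le> gauss_C (\<alpha> * sum P T / (1 + \<alpha> * sum P (\<Omega> - U)))" if T: "T \<subseteq> U" for T
      proof (rule ccontr)
        assume "\<not> ?thesis"
        then have "eventually (\<lambda>x. gauss_C (x * sum P T / (1 + x * sum P (\<Omega> - U))) < sum r T) (at_right \<alpha>)"
          using T UO by (intro order_tendstoD(2)[OF tend[of T "\<Omega> - U"]]) auto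
        from frequently_eventually_conj[OF U this]
        obtain x where x: "Mx x U" "gauss_C (x * sum P T / (1 + x * sum P (\<Omega> - U))) < sum r T"
          by (auto dest!: frequently_ex)
        then have "T \<noteq> {}" by auto
        then have "sum r T < gauss_C (x * sum P T / (1 + x * sum P (\<Omega> - U)))"
          using x(1) T unfolding Mx_def decodable_def PX by blast
        with x(2) show False by simp
      qed
      then show ?thesis
        using tight_decodable[of \<Omega> "\<lambda>l. \<alpha> * P l" U r] UO(1) \<alpha>0 Pos[THEN less_imp_le] at_\<alpha> unfolding PX by simp
    qed
    \<comment> \<open>Three losses of \<open>\<delta> / 4\<close> arise: from the distance of
      \<open>x\<close> to the threshold, from the induction hypothesis and from the decoding step.
      \<open>scale\<close> carries the bound from \<open>x\<close> back to \<open>a\<close> without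
      loss.\<close>
    have d4: "\<delta> / 4 > 0" using less.prems by simp
    have "eventually (\<lambda>x. gauss_C (x * sum P U / (1 + x * sum P (\<Omega> - U))) < sum r U + \<delta> / 4) (at_right \<alpha>)"
      using UO d4 unfolding tight by (intro order_tendstoD(2)[OF tend[of U "\<Omega> - U"]]) auto
    moreover have "eventually (\<lambda>x. \<alpha> < x) (at_right \<alpha>)" by (rule eventually_at_right_less)
    ultimately have "eventually (\<lambda>x. gauss_C (x * sum P U / (1 + x * sum P (\<Omega> - U))) < sum r U + \<delta> / 4 \<and> \<alpha> < x) (at_right \<alpha>)"
      by (rule eventually_conj)
    from frequently_eventually_conj[OF U this]
    obtain x where x: "Mx x U" "gauss_C (x * sum P U / (1 + x * sum P (\<Omega> - U))) < sum r U + \<delta> / 4" "\<alpha> < x"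
      by (auto dest!: frequently_ex)
    have x0: "0 < x" "a \<le> x" using x \<alpha>0 a\<alpha> by auto
    have "card (\<Omega> - U) < card \<Omega>" using UO by (intro psubset_card_mono) auto
    then have "eventually (\<lambda>n. gauss_C (x * sum P (\<Omega> - U)) - \<delta> / 4 \<le> H n (\<Omega> - U) x) sequentially"
      using less.hyps[of "\<Omega> - U" x "\<delta> / 4"] less.prems(1) x0 x(1) d4 by (auto simp: Mx_def)
    moreover have "eventually (\<lambda>n. H n (\<Omega> - U) x + sum r U - \<delta> / 4 \<le> H n \<Omega> x) sequentially"
      using less.prems(1) x0 x(1) d4 by (intro decode) (auto simp: Mx_def)
    moreover have "eventually (\<lambda>n. H n \<Omega> x - H n \<Omega> a \<le> gauss_C (x * sum P \<Omega>) - gauss_C (a * sum P \<Omega>)) sequentially"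
      using less.prems(1,2) x0 by (intro scale) auto
    ultimately show ?thesis
    proof eventually_elim
      case (elim n)
      have "gauss_C (x * sum P (\<Omega> - U)) + gauss_C (x * sum P U / (1 + x * sum P (\<Omega> - U))) = gauss_C (x * sum P \<Omega>)"
        using gauss_C_chain[of "x * sum P (\<Omega> - U)" "x * sum P U" 0] x0 Pnn UO
          sum.subset_diff[OF UO(1), of P] by (simp add: distrib_left)
      with elim x(2) less.prems(4) show ?case by linarith
    qed
  qed
qed

section \<open>The outer bound\<close>

text \<open>In bits per symbol, relative to the noise alone; Gaussian codebooks of full power would
  give \<open>gauss_C\<close> of the received power.\<close>

definition entropy_excess :: "nat \<Rightarrow> real ^ 'k \<Rightarrow> 'k set \<Rightarrow> ('k \<Rightarrow> complex) \<Rightarrow> 'k code_sequence \<Rightarrow> real" where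
  "entropy_excess n R W h c = (output_entropy n R W h c - real n * ln pi - real n) / (real n * ln 2)"

text \<open>Based on the rounded sizes of the message sets: for \<open>n \<ge> 1\<close> it
  dominates the sum of the nominal rates, and it is exactly additive.\<close>

definition message_rate :: "nat \<Rightarrow> real ^ 'k \<Rightarrow> 'k set \<Rightarrow> real" where
  "message_rate n R W = ln (card (messages n R W)) / (real n * ln 2)"

lemma message_rate_ge:
  "n \<ge> 1 \<Longrightarrow> (\<Sum>l\<in>W. R $ l) \<le> message_rate n R (W :: 'k::finite set)"
  using ln_card_messages_ge[of n R W] by (simp add: message_rate_def pos_le_divide_eq mult_ac)

text \<open>A crude bound, one bit per symbol for rounding. It serves as a factor independent of
  \<open>n\<close> in front of a vanishing error probability.\<close>

lemma message_rate_le: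
  assumes "n \<ge> 1" "\<And>l. 0 \<le> R $ l"
  shows "message_rate n R (W :: 'k::finite set) \<le> (\<Sum>l\<in>W. R $ l) + real (card W)"
proof -
  have "ln (card (messages n R W)) \<le> real n * ln 2 * (\<Sum>l\<in>W. R $ l) + real (card W) * ln 2"
    using assms by (intro ln_card_messages_le) auto
  also have "\<dots> \<le> real n * ln 2 * (\<Sum>l\<in>W. R $ l) + real (card W) * (real n * ln 2)"
    using assms(1) by (intro add_left_mono mult_left_mono) auto
  finally show ?thesis
    using assms(1) by (simp add: message_rate_def pos_divide_le_eq algebra_simps)
qed

lemma message_rate_union:
  assumes "W \<inter> V = {}"
  shows "message_rate n R (W \<union> V) = message_rate n R W + message_rate n R (V :: 'k::finite set)"
  unfolding message_rate_def ln_card_messages using assms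
  by (simp add: sum.union_disjoint add_divide_distrib)

lemma entropy_excess_empty: "entropy_excess n R {} h c = 0"
  by (simp add: entropy_excess_def output_entropy_empty)

lemma entropy_excess_zero_gain:
  "W \<inter> V = {} \<Longrightarrow> (\<And>l. l \<in> W \<Longrightarrow> h l = 0) \<Longrightarrow>
    entropy_excess n R (W \<union> V) h c = entropy_excess n R (V :: 'k::finite set) h c"
  by (simp add: entropy_excess_def output_entropy_zero_gain)

lemma entropy_excess_cong:
  "(\<And>l. l \<in> L \<Longrightarrow> h l = h' l) \<Longrightarrow> entropy_excess n R L h c = entropy_excess n R L h' c"
  using output_entropy_cong[of L h h' n R c] by (simp add: entropy_excess_def)

lemma entropy_excess_union_le:
  assumes "W \<inter> V = {}"
  shows "entropy_excess n R (W \<union> V) h c \<le> message_rate n R W + entropy_excess n R (V :: 'k::finite set) h c"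
  unfolding entropy_excess_def message_rate_def add_divide_distrib[symmetric]
  using output_entropy_le[OF assms, of n R h c] by (intro divide_right_mono) auto

lemma entropy_excess_le:
  assumes "power_constraint Q R UNIV c" "n \<ge> 1" "Q \<ge> 0"
  shows "entropy_excess n R (W :: 'k::finite set) h c \<le> gauss_C (\<Sum>l\<in>W. (cmod (h l))\<^sup>2 * Q)"
proof -
  have "entropy_excess n R W h c \<le> real n * ln (1 + (\<Sum>l\<in>W. (cmod (h l))\<^sup>2 * Q)) / (real n * ln 2)"
    unfolding entropy_excess_def using output_entropy_le_gaussian[OF assms, of W h] by (intro divide_right_mono) auto
  then show ?thesis using assms(2) by (simp add: gauss_C_def log_def)
qed

lemma entropy_excess_scale_le:
  assumes "power_constraint Q R UNIV c" "n \<ge> 1" "Q \<ge> 0" "b \<ge> 1"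
  shows "entropy_excess n R (W :: 'k::finite set) (\<lambda>l. complex_of_real (sqrt b) * h l) c - entropy_excess n R W h c
    \<le> gauss_C (b * (\<Sum>l\<in>W. (cmod (h l))\<^sup>2 * Q)) - gauss_C (\<Sum>l\<in>W. (cmod (h l))\<^sup>2 * Q)"
proof -
  let ?P = "\<Sum>l\<in>W. (cmod (h l))\<^sup>2 * Q"
  have P: "?P \<ge> 0" using assms(3) by (intro sum_nonneg) auto
  then have pos: "1 + ?P > 0" "1 + b * ?P > 0" using assms(4) by (auto intro!: add_pos_nonneg)
  have "entropy_excess n R W (\<lambda>l. complex_of_real (sqrt b) * h l) c - entropy_excess n R W h c
    = (output_entropy n R W (\<lambda>l. complex_of_real (sqrt b) * h l) c - output_entropy n R W h c) / (real n * ln 2)"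
    unfolding entropy_excess_def diff_divide_distrib[symmetric] by simp
  also have "\<dots> \<le> real n * ln ((1 + b * ?P) / (1 + ?P)) / (real n * ln 2)"
    using output_entropy_scale_le[OF assms, of W h] by (intro divide_right_mono) auto
  also have "\<dots> = gauss_C (b * ?P) - gauss_C ?P"
    using assms(2) pos by (simp add: gauss_C_def log_def ln_divide_pos diff_divide_distrib)
  finally show ?thesis .
qed

lemma eventually_fano:
  assumes UV: "U \<inter> V = {}" and d: "measurable_decoders U d" and R: "\<And>l. 0 \<le> R $ l"
    and err: "(\<lambda>n. \<Sum>j\<in>U. error_prob n R (U \<union> V) h c j d) \<longlonglongrightarrow> 0" and "\<delta> > 0"
  shows "eventually (\<lambda>n. message_rate n R U + entropy_excess n R V h c - \<delta>
    \<le> entropy_excess n R (U \<union> V :: 'k::finite set) h c) sequentially"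
proof -
  define E where "E n = (\<Sum>j\<in>U. error_prob n R (U \<union> V) h c j d)" for n
  define B where "B = (\<Sum>l\<in>U. R $ l) + real (card U)"
  have "(\<lambda>n. 1 / real n + B * E n) \<longlonglongrightarrow> 0 + B * 0"
    using err unfolding E_def by (intro tendsto_intros lim_1_over_n)
  then have "eventually (\<lambda>n. 1 / real n + B * E n < \<delta>) sequentially"
    using \<open>\<delta> > 0\<close> by (auto dest: order_tendstoD(2))
  moreover have "eventually (\<lambda>n. n \<ge> 1) sequentially" by (rule eventually_ge_at_top)
  ultimately show ?thesis
  proof eventually_elim
    case (elim n)
    have E0: "E n \<ge> 0" by (auto simp: E_def error_prob_def intro!: sum_nonneg)
    have "ln (card (messages n R U)) + output_entropy n R V h c - output_entropy n R (U \<union> V) h c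
       \<le> ln 2 + ln (card (messages n R U)) * E n"
      unfolding E_def by (rule fano_messages[OF UV d])
    then have "(ln (card (messages n R U)) + output_entropy n R V h c - output_entropy n R (U \<union> V) h c) / (real n * ln 2)
       \<le> (ln 2 + ln (card (messages n R U)) * E n) / (real n * ln 2)"
      by (intro divide_right_mono) auto
    also have "\<dots> = 1 / real n + message_rate n R U * E n"
      by (simp add: message_rate_def add_divide_distrib)
    also have "(ln (card (messages n R U)) + output_entropy n R V h c - output_entropy n R (U \<union> V) h c) / (real n * ln 2)
      = message_rate n R U + entropy_excess n R V h c - entropy_excess n R (U \<union> V) h c"
      by (simp add: message_rate_def entropy_excess_def add_divide_distrib diff_divide_distrib)
    finally have "message_rate n R U + entropy_excess n R V h c - entropy_excess n R (U \<union> V) h c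
      \<le> 1 / real n + message_rate n R U * E n" .
    also have "message_rate n R U * E n \<le> B * E n"
      unfolding B_def using elim R E0 by (intro mult_right_mono message_rate_le) auto
    finally show ?case using elim by linarith
  qed
qed

text \<open>The guarantee for the code has all of \<open>L\<close> active. Gain 0 outside
  \<open>\<Omega>\<close> turns it into one for \<open>\<Omega>\<close>, with the powers inside
  unchanged.\<close>

lemma mac_decode_entropy:
  fixes \<Omega> :: "'k::finite set"
  assumes code: "mac_capacity_achieving Q R L c" and R: "\<And>l. 0 \<le> R $ l" and "\<Omega> \<subseteq> L"
    and dec: "decodable (\<lambda>l. R $ l) (\<lambda>l. (cmod (h l))\<^sup>2 * Q) \<Omega> U" and "\<delta> > 0"
  shows "eventually (\<lambda>n. message_rate n R U + entropy_excess n R (\<Omega> - U) h c - \<delta>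
    \<le> entropy_excess n R \<Omega> h c) sequentially"
proof -
  define h' where "h' = (\<lambda>l. if l \<in> \<Omega> then h l else 0)"
  have U: "U \<noteq> {}" "U \<subseteq> \<Omega>" using dec by (auto simp: decodable_def)
  have eq1: "(\<Sum>l\<in>T. (cmod (h' l))\<^sup>2 * Q) = (\<Sum>l\<in>T. (cmod (h l))\<^sup>2 * Q)" if "T \<subseteq> U" for T
    using that U by (intro sum.cong) (auto simp: h'_def)
  have eq2: "(\<Sum>l\<in>L - U. (cmod (h' l))\<^sup>2 * Q) = (\<Sum>l\<in>\<Omega> - U. (cmod (h l))\<^sup>2 * Q)"
    using \<open>\<Omega> \<subseteq> L\<close> by (intro sum.mono_neutral_cong_right) (auto simp: h'_def)
  have "mac_achieves R L U h' c"
  proof -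
    have "\<forall>T. T \<noteq> {} \<longrightarrow> T \<subseteq> U \<longrightarrow> (\<Sum>l\<in>T. R $ l)
          < gauss_C ((\<Sum>l\<in>T. (cmod (h' l))\<^sup>2 * Q) / (1 + (\<Sum>l\<in>L - U. (cmod (h' l))\<^sup>2 * Q)))"
      unfolding eq2 using dec eq1 by (simp add: decodable_def)
    then show ?thesis
      using code U \<open>\<Omega> \<subseteq> L\<close> unfolding mac_capacity_achieving_def by (meson order_trans)
  qed
  then obtain d where d: "measurable_decoders U d"
    and lim: "(\<lambda>n. (1 / real (card U)) * (\<Sum>j\<in>U. error_prob n R L h' c j d)) \<longlonglongrightarrow> 0"
    unfolding mac_achieves_def by blast
  have cU: "real (card U) > 0" using U by (simp add: card_gt_0_iff)
  have UL: "U \<inter> (L - U) = {}" "U \<union> (L - U) = L" using U \<open>\<Omega> \<subseteq> L\<close> by auto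
  have "(\<lambda>n. \<Sum>j\<in>U. error_prob n R (U \<union> (L - U)) h' c j d) \<longlonglongrightarrow> 0"
    using tendsto_mult_left[OF lim, of "real (card U)"] cU UL(2) U(1) by simp
  from eventually_fano[OF UL(1) d R this \<open>\<delta> > 0\<close>]
  have ev: "eventually (\<lambda>n. message_rate n R U + entropy_excess n R (L - U) h' c - \<delta> \<le> entropy_excess n R L h' c) sequentially"
    unfolding UL(2) .
  have "entropy_excess n R (X \<union> (L - \<Omega>)) h' c = entropy_excess n R X h c" if "X \<subseteq> \<Omega>" for X n
  proof -
    have "entropy_excess n R ((L - \<Omega>) \<union> X) h' c = entropy_excess n R X h' c"
      using that by (intro entropy_excess_zero_gain) (auto simp: h'_def)
    also have "\<dots> = entropy_excess n R X h c" using that by (intro entropy_excess_cong) (auto simp: h'_def)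
    finally show ?thesis by (simp add: Un_commute)
  qed
  from this[of "\<Omega> - U"] this[of \<Omega>]
  have "entropy_excess n R (L - U) h' c = entropy_excess n R (\<Omega> - U) h c" "entropy_excess n R L h' c = entropy_excess n R \<Omega> h c" for n
  proof -
    have "\<Omega> - U \<union> (L - \<Omega>) = L - U" "\<Omega> \<union> (L - \<Omega>) = L" using U \<open>\<Omega> \<subseteq> L\<close> by auto
    with \<open>\<And>n. \<Omega> - U \<subseteq> \<Omega> \<Longrightarrow> _ n\<close> \<open>\<And>n. \<Omega> \<subseteq> \<Omega> \<Longrightarrow> _ n\<close>
    show "entropy_excess n R (L - U) h' c = entropy_excess n R (\<Omega> - U) h c" "entropy_excess n R L h' c = entropy_excess n R \<Omega> h c"
      by simp_all
  qed
  with ev show ?thesis by simp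
qed

text \<open>The power factor \<open>a\<close> is realised by multiplying the gains by
  \<open>sqrt a\<close>; the same codebooks are good on all of these channels.\<close>

lemma undecodable_near_gaussian:
  fixes \<Omega> :: "'k::finite set"
  assumes power: "power_constraint Q R UNIV c" and "Q > 0"
    and code: "mac_capacity_achieving Q R L c" and R: "\<And>l. 0 \<le> R $ l" and \<Omega>: "\<Omega> \<subseteq> L"
    and none: "\<And>U. \<not> decodable (\<lambda>l. R $ l) (\<lambda>l. (cmod (h l))\<^sup>2 * Q) \<Omega> U" and "\<delta> > 0"
  shows "eventually (\<lambda>n. gauss_C (\<Sum>l\<in>\<Omega>. (cmod (h l))\<^sup>2 * Q) - \<delta> \<le> entropy_excess n R \<Omega> h c) sequentially"
proof -
  let ?P = "\<lambda>l. (cmod (h l))\<^sup>2 * Q"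
  let ?g = "\<lambda>a l. complex_of_real (sqrt a) * h l"
  \<comment> \<open>Transmitters of gain 0 stay undecodable at every amplification and contribute
    nothing to the output, so they are set aside.\<close>
  define \<Omega>' where "\<Omega>' = {l \<in> \<Omega>. h l \<noteq> 0}"
  have gP: "(cmod (?g a l))\<^sup>2 * Q = a * ?P l" if "a > 0" for a l
    using that by (simp add: norm_mult power_mult_distrib)
  have sum_\<Omega>': "sum ?P (\<Omega> - U) = sum ?P (\<Omega>' - U)" for U
    by (rule sum.mono_neutral_right) (auto simp: \<Omega>'_def)
  have excess_\<Omega>': "entropy_excess n R \<Omega> h c = entropy_excess n R \<Omega>' h c" for n
  proof -
    have "entropy_excess n R ((\<Omega> - \<Omega>') \<union> \<Omega>') h c = entropy_excess n R \<Omega>' h c"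
      by (rule entropy_excess_zero_gain) (auto simp: \<Omega>'_def)
    moreover have "(\<Omega> - \<Omega>') \<union> \<Omega>' = \<Omega>" by (auto simp: \<Omega>'_def)
    ultimately show ?thesis by simp
  qed
  have "eventually (\<lambda>n. gauss_C (1 * sum ?P \<Omega>') - \<delta> \<le> entropy_excess n R \<Omega>' (?g 1) c) sequentially"
  proof (rule eventually_near_gaussian[where r = "\<lambda>l. R $ l" and L = \<Omega>' and H = "\<lambda>n W a. entropy_excess n R W (?g a) c"])
    show "0 < ?P l" if "l \<in> \<Omega>'" for l using that \<open>Q > 0\<close> by (auto simp: \<Omega>'_def)
    show "eventually (\<lambda>n. entropy_excess n R {} (?g a) c = 0) sequentially" for a
      by (simp add: entropy_excess_empty)
    show "eventually (\<lambda>n. entropy_excess n R W (?g x) c - entropy_excess n R W (?g a) c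
        \<le> gauss_C (x * sum ?P W) - gauss_C (a * sum ?P W)) sequentially"
      if "W \<subseteq> \<Omega>'" "0 < a" "a \<le> x" for W a x
      using eventually_ge_at_top[of 1]
    proof (rule eventually_mono)
      fix n :: nat assume n: "1 \<le> n"
      \<comment> \<open>Passing from factor \<open>a\<close> to \<open>x\<close> amplifies the
        channel already scaled by \<open>sqrt a\<close> by a further
        \<open>sqrt (x / a)\<close>.\<close>
      have g: "(\<lambda>l. complex_of_real (sqrt (x / a)) * ?g a l) = ?g x"
        using that(2) by (auto simp: real_sqrt_divide)
      have "(\<Sum>l\<in>W. (cmod (?g a l))\<^sup>2 * Q) = a * sum ?P W"
        unfolding gP[OF that(2)] by (simp add: sum_distrib_left)
      then show "entropy_excess n R W (?g x) c - entropy_excess n R W (?g a) c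
        \<le> gauss_C (x * sum ?P W) - gauss_C (a * sum ?P W)"
        using entropy_excess_scale_le[OF power n, of "x / a" W "?g a"] that \<open>Q > 0\<close> unfolding g by simp
    qed
    show "eventually (\<lambda>n. entropy_excess n R (W - U) (?g a) c + sum (($) R) U - \<epsilon> \<le> entropy_excess n R W (?g a) c) sequentially"
      if "W \<subseteq> \<Omega>'" "0 < a" "decodable (($) R) (\<lambda>l. a * ?P l) W U" "0 < \<epsilon>" for W a U \<epsilon>
    proof -
      have "eventually (\<lambda>n. message_rate n R U + entropy_excess n R (W - U) (?g a) c - \<epsilon> \<le> entropy_excess n R W (?g a) c) sequentially"
        using that \<Omega> by (intro mac_decode_entropy[OF code R]) (auto simp: gP \<Omega>'_def)
      with eventually_ge_at_top[of 1] show ?thesis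
      proof eventually_elim
        case (elim n)
        with message_rate_ge[of n R U] show ?case by linarith
      qed
    qed
    show "\<not> decodable (($) R) (\<lambda>l. 1 * ?P l) \<Omega>' U" for U
      using none[of U] sum_\<Omega>'[of U] unfolding decodable_def by (auto simp: \<Omega>'_def)
  qed (use \<open>\<delta> > 0\<close> in auto)
  then show ?thesis using sum_\<Omega>'[of "{}"] by (simp add: excess_\<Omega>')
qed

lemma achievable_in_region_C:
  fixes g :: "complex ^ 'k ^ 'k"
  assumes "Q > 0" and ach: "achievable_mac_codes g Q R"
  shows "R \<in> region_C g Q j"
proof -
  let ?h = "\<lambda>l. g $ j $ l"
  let ?P = "\<lambda>l. (cmod (?h l))\<^sup>2 * Q"
  have R: "\<And>l. 0 \<le> R $ l" using ach by (simp add: achievable_mac_codes_def)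
  obtain c d where power: "power_constraint Q R UNIV c"
    and codes: "\<And>L. card L = CARD('k) - 1 \<Longrightarrow> mac_capacity_achieving Q R L c"
    and d: "measurable_decoders UNIV d"
    and lim: "(\<lambda>n. (1 / real CARD('k)) * (\<Sum>i\<in>UNIV. error_prob n R UNIV (\<lambda>l. g $ i $ l) c i d)) \<longlonglongrightarrow> 0"
    using ach unfolding achievable_mac_codes_def by blast
  have code: "mac_capacity_achieving Q R (- {j}) c"
    by (intro codes) (simp add: Compl_eq_Diff_UNIV card_Diff_singleton)
  have err_nn: "0 \<le> error_prob n R L h c i d" for n L h i by (simp add: error_prob_def)
  have err: "(\<lambda>n. error_prob n R UNIV ?h c j d) \<longlonglongrightarrow> 0"
  proof (rule tendsto_sandwich[OF always_eventually always_eventually tendsto_const])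
    show "(\<lambda>n. \<Sum>i\<in>UNIV. error_prob n R UNIV (\<lambda>l. g $ i $ l) c i d) \<longlonglongrightarrow> 0"
      using tendsto_mult_left[OF lim, of "real CARD('k)"] by simp
    show "\<forall>n. error_prob n R UNIV ?h c j d \<le> (\<Sum>i\<in>UNIV. error_prob n R UNIV (\<lambda>l. g $ i $ l) c i d)"
      using member_le_sum[of j UNIV "\<lambda>i. error_prob _ R UNIV (\<lambda>l. g $ i $ l) c i d"] err_nn by auto
  qed (use err_nn in auto)
  let ?X = "\<lambda>n W. entropy_excess n R W ?h c"
  \<comment> \<open>\<open>eq n S\<close> is the conditional entropy per symbol of the messages in \<open>S\<close> given the output.\<close>
  define eq where "eq n S = message_rate n R S + ?X n (- S) - ?X n UNIV" for n S
  define resolved where "resolved S \<longleftrightarrow> j \<in> S \<and> (\<forall>\<delta>>0. eventually (\<lambda>n. eq n S \<le> \<delta>) sequentially)" for S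
  \<comment> \<open>The receiver's own decoder has vanishing error, so Fano's inequality with all
    other transmitters as interference provides a first set.\<close>
  have "resolved {j}"
    unfolding resolved_def
  proof (intro conjI allI impI)
    fix \<delta> :: real assume "\<delta> > 0"
    have "measurable_decoders {j} d" using d by (simp add: measurable_decoders_def)
    from eventually_fano[OF _ this R _ \<open>\<delta> > 0\<close>, of "- {j}" ?h c]
    show "eventually (\<lambda>n. eq n {j} \<le> \<delta>) sequentially"
      using err by (auto simp: eq_def insert_UNIV elim!: eventually_mono)
  qed simp
  then obtain S where S: "resolved S" and max: "\<And>S'. resolved S' \<Longrightarrow> S \<subseteq> S' \<Longrightarrow> S' = S"
    using finite_has_maximal[of "Collect resolved"] by auto
  have jS: "j \<in> S" using S by (simp add: resolved_def)
  have none: "\<not> decodable (\<lambda>l. R $ l) ?P (- S) U" for U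
  proof
    assume U: "decodable (\<lambda>l. R $ l) ?P (- S) U"
    then have US: "U \<noteq> {}" "U \<subseteq> - S" by (auto simp: decodable_def)
    \<comment> \<open>Chain rule: the equivocation of \<open>S \<union> U\<close> is that of
      \<open>S\<close> plus that of \<open>U\<close> once the signals of \<open>S\<close> are
      subtracted, and the latter vanishes by the guarantee for \<open>U\<close>.\<close>
    have "resolved (S \<union> U)"
      unfolding resolved_def
    proof (intro conjI allI impI)
      show "j \<in> S \<union> U" using jS by simp
      fix \<delta> :: real assume "\<delta> > 0"
      then have d2: "\<delta> / 2 > 0" by simp
      have "eventually (\<lambda>n. message_rate n R U + ?X n (- S - U) - \<delta> / 2 \<le> ?X n (- S)) sequentially"
        using jS by (intro mac_decode_entropy[OF code R _ U d2]) auto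
      moreover have "eventually (\<lambda>n. eq n S \<le> \<delta> / 2) sequentially" using S d2 unfolding resolved_def by blast
      ultimately show "eventually (\<lambda>n. eq n (S \<union> U) \<le> \<delta>) sequentially"
      proof eventually_elim
        case (elim n)
        have "S \<inter> U = {}" "- (S \<union> U) = - S - U" using US by auto
        with elim show ?case unfolding eq_def by (simp add: message_rate_union)
      qed
    qed
    from max[OF this] US show False by auto
  qed
  \<comment> \<open>The messages in \<open>S - T\<close> account for at most
    \<open>message_rate n R (S - T)\<close> of the output entropy. What is left for \<open>T\<close>
    is the Gaussian bound for \<open>T \<union> - S\<close> minus the near-Gaussian entropy of
    \<open>- S\<close>; the chain rule turns this difference into the constraint.\<close>
  have "(\<Sum>l\<in>T. R $ l) \<le> gauss_C (sum ?P T / (1 + sum ?P (- S)))" if T: "T \<subseteq> S" for T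
  proof (rule field_le_epsilon)
    fix \<delta> :: real assume "\<delta> > 0"
    then have d2: "\<delta> / 2 > 0" by simp
    have "eventually (\<lambda>n. gauss_C (sum ?P (- S)) - \<delta> / 2 \<le> ?X n (- S)) sequentially"
      using jS assms(1) by (intro undecodable_near_gaussian[OF power _ code R _ none d2]) auto
    moreover have "eventually (\<lambda>n. eq n S \<le> \<delta> / 2) sequentially" using S d2 unfolding resolved_def by blast
    moreover have "eventually (\<lambda>n. n \<ge> 1) sequentially" by (rule eventually_ge_at_top)
    ultimately have "eventually (\<lambda>n. gauss_C (sum ?P (- S)) - \<delta> / 2 \<le> ?X n (- S) \<and> eq n S \<le> \<delta> / 2 \<and> n \<ge> 1) sequentially"
      by eventually_elim simp
    \<comment> \<open>The desired inequality does not involve \<open>n\<close>, so one good block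
      length suffices.\<close>
    then obtain n where n: "gauss_C (sum ?P (- S)) - \<delta> / 2 \<le> ?X n (- S)" "eq n S \<le> \<delta> / 2" "n \<ge> 1"
      using eventually_happens'[OF sequentially_bot] by blast
    have sets: "(S - T) \<inter> (T \<union> - S) = {}" "(S - T) \<union> (T \<union> - S) = UNIV" "T \<inter> (S - T) = {}" "T \<union> (S - T) = S"
      "T \<inter> - S = {}"
      using T by auto
    have "?X n UNIV \<le> message_rate n R (S - T) + ?X n (T \<union> - S)"
      using entropy_excess_union_le[OF sets(1), of n R ?h c] unfolding sets(2) .
    moreover have "message_rate n R S = message_rate n R T + message_rate n R (S - T)"
      using message_rate_union[OF sets(3), of n R] unfolding sets(4) .
    moreover have "?X n (T \<union> - S) \<le> gauss_C (sum ?P (T \<union> - S))"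
      using assms(1) by (intro entropy_excess_le[OF power n(3)]) simp
    moreover have "gauss_C (sum ?P (T \<union> - S)) = gauss_C (sum ?P (- S)) + gauss_C (sum ?P T / (1 + sum ?P (- S)))"
      using gauss_C_chain[of "sum ?P (- S)" "sum ?P T" 0] sets(5) assms(1)
      by (simp add: sum.union_disjoint sum_nonneg add.commute)
    ultimately show "(\<Sum>l\<in>T. R $ l) \<le> gauss_C (sum ?P T / (1 + sum ?P (- S))) + \<delta>"
      using message_rate_ge[OF n(3), of R T] n unfolding eq_def by linarith
  qed
  then show ?thesis
    using R jS by (auto simp: region_C_def region_A_def rx_power_def)
qed

text \<open>The capacity region is a closure, so the outer bound has to be closed; it is, because
  the constraints are weak and only finitely many sets \<open>S\<close> occur.\<close>

lemma closed_region_C: "closed (region_C g Q j)"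
proof -
  have A: "closed (region_A g Q j S)" for S
  proof -
    have "region_A g Q j S = (\<Inter>T\<in>Pow S. {R. (\<Sum>l\<in>T. R $ l)
      \<le> gauss_C ((\<Sum>l\<in>T. rx_power g Q j l) / (1 + (\<Sum>l\<in>- S. rx_power g Q j l)))})"
      by (auto simp: region_A_def)
    also have "closed \<dots>"
      by (intro closed_INT ballI closed_Collect_le continuous_intros)
    finally show ?thesis .
  qed
  have "region_C g Q j = (\<Inter>l. {R. 0 \<le> R $ l}) \<inter> (\<Union>S\<in>{S. j \<in> S}. region_A g Q j S)"
    by (auto simp: region_C_def)
  also have "closed \<dots>"
    using A by (intro closed_Int closed_INT closed_UN ballI closed_Collect_le continuous_intros) auto
  finally show ?thesis .
qed

theorem theorem3:
  fixes K :: nat and g :: "complex ^ 'k ^ 'k" and Q :: real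
  assumes "K \<ge> 1" and "CARD('k) = K + 1" and "Q > 0"
  shows "capacity_region_mac_codes g Q \<subseteq> (\<Inter>j. region_C g Q j)"
  unfolding capacity_region_mac_codes_def
  using achievable_in_region_C[OF \<open>Q > 0\<close>]
  by (intro closure_minimal closed_INT ballI closed_region_C) auto

end
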